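(* Let $\Gamma$ be a finitely generated group with property $\mathrm{F}\mathbb{R}^{<\infty}$, and fix a finite generating set $S$ of $\Gamma$. Then for each $n\ge1$ there is a constant $\kappa_n>0$ such that for every representation $\rho:\Gamma\to\mathrm{GL}_n(\mathbb{C})$ that is unbounded (i.e. $\rho(\Gamma)$ is not relatively compact in $\mathrm{GL}_n(\mathbb{C})$) one has $\delta(\rho)\ge\kappa_n$. In particular, any small deformation of a unitary representation of $\Gamma$ among linear representations is unitarizable: for every homomorphism $\rho_0:\Gamma\to \mathrm{U}_n(\mathbb{C})$ there is a neighbourhood of $\rho_0$ in $\mathrm{Hom}(\Gamma,\mathrm{GL}_n(\mathbb{C}))$ (with the topology of pointwise convergence) such that every $\rho$ in this neighbourhood is conjugate in $\mathrm{GL}_n(\mathbb{C})$ to a representation into $\mathrm{U}_n(\mathbb{C})$.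
   Context: A group has property $\mathrm{F}\mathbb{R}^{<\infty}$ if, for every $n\in\mathbb{N}$, each of its actions by isometries on Euclidean space $\mathbb{R}^n$ has a global fixed point. For a representation $\rho:\Gamma\to\mathrm{GL}_n(\mathbb{C})$, consider the induced isometric action of $\Gamma$ on the symmetric space $Y=\mathrm{GL}_n(\mathbb{C})/\mathrm{U}_n(\mathbb{C})$, equipped with its standard $\mathrm{GL}_n(\mathbb{C})$-invariant nonpositively curved Riemannian metric, and set $\delta(\rho)=\inf_{x\in Y}\max_{s\in S} d(x,\rho(s)x)$. *)

theory Defs
  imports
    "HOL-Analysis.Analysis"
    "HOL-Algebra.Algebra"
begin

section \<open>Property FR\<close>

text \<open>\<open>\<real>\<^sup>n\<close> is \<open>topspace (Euclidean_space n)\<close>, the sequences vanishing from index \<open>n\<close> on, so that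
  \<open>n\<close> can be quantified inside the property.\<close>

definition euclid_dist :: "nat \<Rightarrow> (nat \<Rightarrow> real) \<Rightarrow> (nat \<Rightarrow> real) \<Rightarrow> real" where
  "euclid_dist n x y = L2_set (\<lambda>i. x i - y i) {..<n}"

definition isometric_action ::
    "('g, 'b) monoid_scheme \<Rightarrow> nat \<Rightarrow> ('g \<Rightarrow> (nat \<Rightarrow> real) \<Rightarrow> (nat \<Rightarrow> real)) \<Rightarrow> bool" where
  "isometric_action G n \<phi> \<longleftrightarrow>
     group_action G (topspace (Euclidean_space n)) \<phi> \<and>
     (\<forall>g\<in>carrier G. \<forall>x\<in>topspace (Euclidean_space n). \<forall>y\<in>topspace (Euclidean_space n).
        euclid_dist n (\<phi> g x) (\<phi> g y) = euclid_dist n x y)"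

definition property_FR :: "('g, 'b) monoid_scheme \<Rightarrow> bool" where
  "property_FR G \<longleftrightarrow>
     (\<forall>n \<phi>. isometric_action G n \<phi> \<longrightarrow>
        (\<exists>x\<in>topspace (Euclidean_space n). \<forall>g\<in>carrier G. \<phi> g x = x))"

section \<open>The general linear and unitary groups\<close>

definition adjoint_matrix :: "complex^'n^'n \<Rightarrow> complex^'n^'n" where
  "adjoint_matrix A = map_matrix cnj (transpose A)"

definition GL :: "(complex^'n^'n) monoid" where
  "GL = \<lparr>carrier = {A. invertible A}, mult = (**), one = mat 1\<rparr>"

definition unitary_matrices :: "(complex^'n^'n) set" where
  "unitary_matrices = {A. adjoint_matrix A ** A = mat 1 \<and> A ** adjoint_matrix A = mat 1}"

definition U :: "(complex^'n^'n) monoid" where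
  "U = GL\<lparr>carrier := unitary_matrices\<rparr>"

section \<open>The symmetric space\<close>

definition sym_space :: "(complex^'n^'n) set set" where
  "sym_space = lcosets\<^bsub>GL\<^esub> unitary_matrices"

definition posdef_matrices :: "(complex^'n^'n) set" where
  "posdef_matrices =
     {p. adjoint_matrix p = p \<and> (\<forall>v. v \<noteq> 0 \<longrightarrow> Re (\<Sum>i\<in>UNIV. cnj (v $ i) * (p *v v) $ i) > 0)}"

text \<open>\<open>A \<mapsto> A A\<^sup>*\<close> induces a bijection from the cosets \<open>A U\<^sub>n\<close> onto the manifold of positive definite
  Hermitian matrices, which carries left translation by \<open>g\<close> to \<open>p \<mapsto> g p g\<^sup>*\<close>.\<close>

definition gram :: "complex^'n^'n \<Rightarrow> complex^'n^'n" where
  "gram A = A ** adjoint_matrix A"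

text \<open>The norm of the invariant Riemannian metric \<open>\<langle>v, w\<rangle>\<^sub>p = tr (p\<^sup>-\<^sup>1 v p\<^sup>-\<^sup>1 w)\<close>; the tangent space at
  \<open>p\<close> consists of the Hermitian matrices.\<close>

definition tangent_norm :: "complex^'n^'n \<Rightarrow> complex^'n^'n \<Rightarrow> real" where
  "tangent_norm p v = sqrt (Re (trace (matrix_inv p ** v ** matrix_inv p ** v)))"

definition curve_length :: "(real \<Rightarrow> complex^'n^'n) \<Rightarrow> real" where
  "curve_length c = integral {0..1} (\<lambda>t. tangent_norm (c t) (vector_derivative c (at t)))"

text \<open>\<open>C\<^sup>1\<close> curves suffice for the Riemannian distance. The library's \<open>piecewise_C1_differentiable_on\<close> is
  unsuitable here: it admits curves of infinite length, whose \<open>integral\<close> is \<open>0\<close> by convention.\<close>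

definition sym_dist :: "(complex^'n^'n) set \<Rightarrow> (complex^'n^'n) set \<Rightarrow> real" where
  "sym_dist C D =
     Inf {curve_length c | c. c C1_differentiable_on {0..1} \<and> c ` {0..1} \<subseteq> posdef_matrices \<and>
            c 0 \<in> gram ` C \<and> c 1 \<in> gram ` D}"

definition displacement :: "'g set \<Rightarrow> ('g \<Rightarrow> complex^'n^'n) \<Rightarrow> real" where
  "displacement S \<rho> = (INF x\<in>sym_space. MAX s\<in>S. sym_dist x (\<rho> s <#\<^bsub>GL\<^esub> x))"

section \<open>Representations\<close>

definition unbounded_rep :: "('g, 'b) monoid_scheme \<Rightarrow> ('g \<Rightarrow> complex^'n^'n) \<Rightarrow> bool" where
  "unbounded_rep G \<rho> \<longleftrightarrow>
     \<not> compactin (top_of_set (carrier GL)) (top_of_set (carrier GL) closure_of (\<rho> ` carrier G))"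

text \<open>\<open>Hom(G, GL\<^sub>n)\<close> with the topology of pointwise convergence; its points are the homomorphisms
  that are \<open>extensional\<close> on \<open>carrier G\<close>, which makes a homomorphism determined by its values there.\<close>

definition rep_space :: "('g, 'b) monoid_scheme \<Rightarrow> ('g \<Rightarrow> complex^'n^'n) topology" where
  "rep_space G =
     subtopology (product_topology (\<lambda>_. top_of_set (carrier GL)) (carrier G)) (hom G GL)"

definition unitarizable :: "('g, 'b) monoid_scheme \<Rightarrow> ('g \<Rightarrow> complex^'n^'n) \<Rightarrow> bool" where
  "unitarizable G \<rho> \<longleftrightarrow> (\<exists>A\<in>carrier GL. (\<lambda>g. A ** \<rho> g ** matrix_inv A) \<in> hom G U)"

section \<open>Consistency of the definitions\<close>

lemma adjoint_matrix_mult: "adjoint_matrix (A ** B) = adjoint_matrix B ** adjoint_matrix A"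
  by (simp add: adjoint_matrix_def vec_eq_iff matrix_matrix_mult_def transpose_def
      map_matrix_def mult.commute)

lemma adjoint_matrix_adjoint [simp]: "adjoint_matrix (adjoint_matrix A) = A"
  by (simp add: adjoint_matrix_def vec_eq_iff transpose_def map_matrix_def)

lemma adjoint_matrix_one [simp]: "adjoint_matrix (mat 1) = mat 1"
  by (simp add: adjoint_matrix_def vec_eq_iff transpose_def map_matrix_def mat_def)

lemma group_GL: "group (GL :: (complex^'n^'n) monoid)"
proof (rule groupI)
  fix A :: "complex^'n^'n"
  assume "A \<in> carrier GL"
  then obtain B where "A ** B = mat 1" "B ** A = mat 1"
    by (auto simp: GL_def invertible_def)
  then show "\<exists>B\<in>carrier GL. B \<otimes>\<^bsub>GL\<^esub> A = \<one>\<^bsub>GL\<^esub>"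
    by (auto simp: GL_def invertible_def)
next
  show "\<one>\<^bsub>GL\<^esub> \<in> carrier (GL :: (complex^'n^'n) monoid)"
    by (auto simp: GL_def invertible_def)
qed (auto simp: GL_def invertible_mult matrix_mul_assoc)

lemma inv_GL:
  fixes A :: "complex^'n^'n"
  assumes "A ** B = mat 1" "B ** A = mat 1"
  shows "inv\<^bsub>GL\<^esub> A = B"
  using assms by (intro group.inv_equality[OF group_GL]) (auto simp: GL_def invertible_def)

lemma subgroup_U: "subgroup (unitary_matrices :: (complex^'n^'n) set) GL"
proof (rule group.subgroupI[OF group_GL])
  show "(unitary_matrices :: (complex^'n^'n) set) \<subseteq> carrier GL"
    by (auto simp: unitary_matrices_def GL_def invertible_def)
  show "(unitary_matrices :: (complex^'n^'n) set) \<noteq> {}"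
    by (auto simp: unitary_matrices_def intro!: exI[of _ "mat 1"])
next
  fix A :: "complex^'n^'n"
  assume "A \<in> unitary_matrices"
  then show "inv\<^bsub>GL\<^esub> A \<in> unitary_matrices"
    using inv_GL[of A "adjoint_matrix A"] by (auto simp: unitary_matrices_def)
next
  fix A B :: "complex^'n^'n"
  assume A: "A \<in> unitary_matrices" and B: "B \<in> unitary_matrices"
  have "adjoint_matrix B ** adjoint_matrix A ** (A ** B)
      = adjoint_matrix B ** (adjoint_matrix A ** A) ** B"
    "A ** B ** (adjoint_matrix B ** adjoint_matrix A)
      = A ** (B ** adjoint_matrix B) ** adjoint_matrix A"
    by (simp_all add: matrix_mul_assoc)
  then show "A \<otimes>\<^bsub>GL\<^esub> B \<in> unitary_matrices"
    using A B by (simp add: unitary_matrices_def GL_def adjoint_matrix_mult)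
qed

lemma gram_translate: "gram (A ** B) = A ** gram B ** adjoint_matrix A"
  by (simp add: gram_def adjoint_matrix_mult matrix_mul_assoc)

lemma gram_coset:
  fixes A :: "complex^'n^'n"
  shows "gram ` (A <#\<^bsub>GL\<^esub> unitary_matrices) = {gram A}"
proof -
  have "gram (A ** u) = gram A" if "u \<in> unitary_matrices" for u
    using that unfolding gram_translate by (simp add: gram_def unitary_matrices_def)
  moreover have "mat 1 \<in> (unitary_matrices :: (complex^'n^'n) set)"
    by (simp add: unitary_matrices_def)
  ultimately show ?thesis
    unfolding l_coset_def by (auto simp: GL_def image_iff)
qed

lemma gram_eq_iff:
  fixes A B :: "complex^'n^'n"
  assumes "A \<in> carrier GL" "B \<in> carrier GL"
  shows "gram A = gram B \<longleftrightarrow> A <#\<^bsub>GL\<^esub> unitary_matrices = B <#\<^bsub>GL\<^esub> unitary_matrices"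
proof
  assume eq: "gram A = gram B"
  obtain C where C: "A ** C = mat 1" "C ** A = mat 1"
    using assms by (auto simp: GL_def invertible_def)
  obtain D where D: "B ** D = mat 1" "D ** B = mat 1"
    using assms by (auto simp: GL_def invertible_def)
  define u where "u = C ** B"
  have "gram u = C ** gram A ** adjoint_matrix C"
    using eq by (simp add: u_def gram_translate)
  also have "\<dots> = (C ** A) ** adjoint_matrix (C ** A)"
    by (simp add: gram_def adjoint_matrix_mult matrix_mul_assoc)
  finally have u1: "u ** adjoint_matrix u = mat 1"
    using C by (simp add: gram_def)
  then have "u \<in> unitary_matrices"
    using matrix_left_right_inverse[of u "adjoint_matrix u"] by (simp add: unitary_matrices_def)
  moreover have "B = A ** u"
    using C by (simp add: u_def matrix_mul_assoc)
  ultimately have "B \<in> A <#\<^bsub>GL\<^esub> unitary_matrices"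
    by (auto simp: l_coset_def GL_def)
  then show "A <#\<^bsub>GL\<^esub> unitary_matrices = B <#\<^bsub>GL\<^esub> unitary_matrices"
    using group.l_repr_independence[OF group_GL _ assms(1) subgroup_U] by blast
next
  assume "A <#\<^bsub>GL\<^esub> unitary_matrices = B <#\<^bsub>GL\<^esub> unitary_matrices"
  then show "gram A = gram B"
    using gram_coset[of A] gram_coset[of B] by simp
qed

end

(*
  Measure how far a representation \<rho> is from being unitary by the defects gram (\<rho> s) - 1 at the
  generators s. If the defects are at most e, with e below a threshold \<eta>, then conjugating by some
  matrix within O(e) of 1 halves them. Otherwise there would be representations \<rho>_k with defects at
  most e_k -> 0 violating this; along a subsequence they converge to a unitary representation u, and
  the defects divided by e_k converge to a cocycle b. By property FR the isometric affine action
  Z |-> u(g) Z u(g)^* + b(g) on the space of matrices has a fixed point Z, which can be taken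
  Hermitian, and conjugating by 1 + e_k Z / 2 reduces the defects to o(e_k), a contradiction.
  Iterating, the conjugating matrices stay bounded together with their inverses, so a limit point
  conjugates \<rho> into U_n. Hence a representation with defects at most \<eta> is unitarizable.

  This gives the statement about deformations at once. For the displacement, every function
  p |-> ln (w^* p w) is 1-Lipschitz on the symmetric space, so a point x = A U_n moved by less than
  \<kappa> by all generators makes the defects of A^-1 \<rho> A at most 2 n (exp \<kappa> - 1); for small \<kappa> the
  representation is unitarizable and therefore bounded.
*)
theory Submission
  imports Defs "HOL-Complex_Analysis.Great_Picard"
begin

section \<open>The Frobenius norm and the adjoint of complex matrices\<close>

lemma nth_adjoint_matrix [simp]: "adjoint_matrix A $ i $ j = cnj (A $ j $ i)"
  by (simp add: adjoint_matrix_def transpose_def)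

lemma norm_matrix_sq: "(norm (A :: complex^'n^'n))\<^sup>2 = (\<Sum>i\<in>UNIV. \<Sum>j\<in>UNIV. (cmod (A $ i $ j))\<^sup>2)"
  by (simp add: norm_vec_def L2_set_def sum_nonneg)

text \<open>Cauchy-Schwarz on each entry of the product. The constant is 1, but
  \<open>norm (mat 1)\<close> is the square root of the dimension, which is why it occurs in later
  bounds.\<close>

lemma norm_matrix_mult_le: "norm (A ** B) \<le> norm (A :: complex^'n^'n) * norm (B :: complex^'n^'n)"
proof -
  have "(norm (A ** B))\<^sup>2 = (\<Sum>i\<in>UNIV. \<Sum>j\<in>UNIV. (cmod (\<Sum>k\<in>UNIV. A $ i $ k * B $ k $ j))\<^sup>2)"
    by (simp add: norm_matrix_sq matrix_matrix_mult_def)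
  also have "\<dots> \<le> (\<Sum>i\<in>UNIV. \<Sum>j\<in>UNIV.
      (\<Sum>k\<in>UNIV. (cmod (A $ i $ k))\<^sup>2) * (\<Sum>k\<in>UNIV. (cmod (B $ k $ j))\<^sup>2))"
  proof (intro sum_mono)
    fix i j :: 'n
    have "cmod (\<Sum>k\<in>UNIV. A $ i $ k * B $ k $ j) \<le> (\<Sum>k\<in>UNIV. cmod (A $ i $ k) * cmod (B $ k $ j))"
      by (rule order_trans[OF norm_sum]) (simp add: norm_mult)
    then have "(cmod (\<Sum>k\<in>UNIV. A $ i $ k * B $ k $ j))\<^sup>2
        \<le> (\<Sum>k\<in>UNIV. cmod (A $ i $ k) * cmod (B $ k $ j))\<^sup>2"
      by (intro power_mono) auto
    also have "\<dots> \<le> (\<Sum>k\<in>UNIV. (cmod (A $ i $ k))\<^sup>2) * (\<Sum>k\<in>UNIV. (cmod (B $ k $ j))\<^sup>2)"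
      by (rule Cauchy_Schwarz_ineq_sum)
    finally show "(cmod (\<Sum>k\<in>UNIV. A $ i $ k * B $ k $ j))\<^sup>2
        \<le> (\<Sum>k\<in>UNIV. (cmod (A $ i $ k))\<^sup>2) * (\<Sum>k\<in>UNIV. (cmod (B $ k $ j))\<^sup>2)" .
  qed
  also have "\<dots> = (norm A)\<^sup>2 * (\<Sum>j\<in>UNIV. \<Sum>k\<in>UNIV. (cmod (B $ k $ j))\<^sup>2)"
    by (simp add: norm_matrix_sq sum_product)
  also have "(\<Sum>j\<in>UNIV. \<Sum>k\<in>UNIV. (cmod (B $ k $ j))\<^sup>2) = (norm B)\<^sup>2"
    unfolding norm_matrix_sq by (rule sum.swap)
  finally show ?thesis
    by (intro power2_le_imp_le[of "norm (A ** B)" "norm A * norm B"])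
      (simp_all add: power_mult_distrib)
qed

lemma bounded_bilinear_matrix_mult:
  "bounded_bilinear ((**) :: complex^'n^'n \<Rightarrow> complex^'n^'n \<Rightarrow> complex^'n^'n)"
proof
  fix A B C :: "complex^'n^'n" and r :: real
  show "(A + B) ** C = A ** C + B ** C" "A ** (B + C) = A ** B + A ** C"
    "(r *\<^sub>R A) ** B = r *\<^sub>R (A ** B)" "A ** (r *\<^sub>R B) = r *\<^sub>R (A ** B)"
    by (simp_all add: vec_eq_iff matrix_matrix_mult_def algebra_simps sum.distrib
        scaleR_sum_right)
  show "\<exists>K. \<forall>(A :: complex^'n^'n) (B :: complex^'n^'n). norm (A ** B) \<le> norm A * norm B * K"
    by (rule exI[of _ 1]) (simp add: norm_matrix_mult_le)
qed

interpretation mat_mult: bounded_bilinear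
  "(**) :: complex^'n^'n \<Rightarrow> complex^'n^'n \<Rightarrow> complex^'n^'n"
  by (rule bounded_bilinear_matrix_mult)

lemma norm_adjoint_matrix [simp]: "norm (adjoint_matrix A) = norm (A :: complex^'n^'n)"
proof -
  have "(norm (adjoint_matrix A))\<^sup>2 = (norm A)\<^sup>2"
    unfolding norm_matrix_sq nth_adjoint_matrix complex_mod_cnj by (rule sum.swap)
  then show ?thesis by simp
qed

lemma bounded_linear_adjoint_matrix:
  "bounded_linear (adjoint_matrix :: complex^'n^'n \<Rightarrow> complex^'n^'n)"
proof
  fix A B :: "complex^'n^'n" and r :: real
  show "adjoint_matrix (A + B) = adjoint_matrix A + adjoint_matrix B"
    "adjoint_matrix (r *\<^sub>R A) = r *\<^sub>R adjoint_matrix A"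
    by (simp_all add: vec_eq_iff)
  show "\<exists>K. \<forall>A :: complex^'n^'n. norm (adjoint_matrix A) \<le> norm A * K"
    by (rule exI[of _ 1]) simp
qed

lemmas tendsto_adjoint_matrix = bounded_linear.tendsto[OF bounded_linear_adjoint_matrix]

lemmas adjoint_matrix_add = linear_add[OF bounded_linear.linear[OF bounded_linear_adjoint_matrix]]
  and adjoint_matrix_diff = linear_diff[OF bounded_linear.linear[OF bounded_linear_adjoint_matrix]]
  and adjoint_matrix_scaleR = linear_scale[OF bounded_linear.linear[OF bounded_linear_adjoint_matrix]]

lemma norm_sq_eq_trace_gram: "complex_of_real ((norm A)\<^sup>2) = trace (gram (A :: complex^'n^'n))"
  by (simp add: norm_matrix_sq gram_def trace_def matrix_matrix_mult_def complex_norm_square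
      del: of_real_power)

lemma norm_trace_le: "cmod (trace A) \<le> real CARD('n) * norm (A :: complex^'n^'n)"
proof -
  have "cmod (A $ i $ j) \<le> norm A" for i j
    by (meson Finite_Cartesian_Product.norm_nth_le order_trans)
  then have "cmod (trace A) \<le> (\<Sum>i\<in>(UNIV::'n set). norm A)"
    unfolding trace_def by (intro sum_norm_le)
  then show ?thesis by simp
qed

text \<open>A bound on the defect thus bounds the matrix itself; this supplies the compactness for
  matrices with small defect.\<close>

lemma norm_sq_le_norm_gram: "(norm A)\<^sup>2 \<le> real CARD('n) * norm (gram (A :: complex^'n^'n))"
proof -
  have "(norm A)\<^sup>2 = cmod (trace (gram A))"
    by (simp add: norm_sq_eq_trace_gram[symmetric] norm_power)
  then show ?thesis using norm_trace_le[of "gram A"] by simp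
qed

text \<open>The squared norm is the trace of \<open>gram\<close>, and the trace is invariant under
  cyclic permutation. This makes the affine action below isometric.\<close>

lemma norm_conj_unitary:
  fixes u Z :: "complex^'n^'n"
  assumes "u \<in> unitary_matrices"
  shows "norm (u ** Z ** adjoint_matrix u) = norm Z"
proof -
  have u: "adjoint_matrix u ** u = mat 1" using assms by (simp add: unitary_matrices_def)
  have "gram (u ** Z ** adjoint_matrix u)
      = u ** (Z ** (adjoint_matrix u ** u) ** adjoint_matrix Z ** adjoint_matrix u)"
    by (simp add: gram_def adjoint_matrix_mult matrix_mul_assoc)
  also have "trace \<dots> = trace (Z ** adjoint_matrix Z ** (adjoint_matrix u ** u))"
    by (subst trace_mul_sym) (simp add: u matrix_mul_assoc[symmetric])
  also have "\<dots> = trace (gram Z)" by (simp add: u gram_def)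
  finally have "complex_of_real ((norm (u ** Z ** adjoint_matrix u))\<^sup>2) = complex_of_real ((norm Z)\<^sup>2)"
    by (simp only: norm_sq_eq_trace_gram)
  then have "(norm (u ** Z ** adjoint_matrix u))\<^sup>2 = (norm Z)\<^sup>2"
    by (simp only: of_real_eq_iff)
  then show ?thesis by simp
qed

lemma matrix_inv_unique:
  fixes A B :: "complex^'n^'n"
  assumes "A ** B = mat 1"
  shows "matrix_inv A = B"
proof -
  have BA: "B ** A = mat 1" using assms matrix_left_right_inverse by blast
  have "A ** matrix_inv A = mat 1 \<and> matrix_inv A ** A = mat 1"
    unfolding matrix_inv_def by (rule someI[of _ B]) (simp add: assms BA)
  then have "matrix_inv A = (B ** A) ** matrix_inv A" by (simp add: BA)
  also have "\<dots> = B" using \<open>A ** matrix_inv A = mat 1 \<and> _\<close> by (simp add: matrix_mul_assoc[symmetric])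
  finally show ?thesis .
qed

text \<open>With \<open>E x = mat 1 - b ** A x\<close> one has \<open>B x - b = E x ** B x\<close>.
  Once \<open>norm (E x) < 1/2\<close> this keeps \<open>norm (B x)\<close> below
  \<open>2 * norm b\<close>, and then \<open>B x - b\<close> tends to 0 together with
  \<open>E x\<close>.\<close>

lemma tendsto_right_inverse_matrix:
  fixes A B :: "'a \<Rightarrow> complex^'n^'n"
  assumes A: "(A \<longlongrightarrow> a) F" and inv: "\<forall>\<^sub>F x in F. A x ** B x = mat 1" and b: "b ** a = mat 1"
  shows "(B \<longlongrightarrow> b) F"
proof -
  define E where "E x = mat 1 - b ** A x" for x
  have E0: "(E \<longlongrightarrow> 0) F"
    unfolding E_def using tendsto_diff[OF tendsto_const mat_mult.tendsto[OF tendsto_const A], of "mat 1" b]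
    by (simp add: b)
  have "\<forall>\<^sub>F x in F. norm (E x) < 1/2"
    using E0[unfolded tendsto_iff, rule_format, of "1/2"] by simp
  then have "\<forall>\<^sub>F x in F. norm (B x - b) \<le> norm (E x) * (2 * norm b)"
    using inv
  proof eventually_elim
    case (elim x)
    have eq: "B x - b = E x ** B x"
      using elim(2) by (simp add: E_def mat_mult.diff_left matrix_mul_assoc[symmetric])
    then have le: "norm (B x - b) \<le> norm (E x) * norm (B x)" by (simp add: norm_matrix_mult_le)
    also have "\<dots> \<le> 1/2 * norm (B x)" using elim(1) by (intro mult_right_mono) auto
    finally have "norm (B x) \<le> 2 * norm b" using norm_triangle_ineq2[of "B x" b] by linarith
    then have "norm (E x) * norm (B x) \<le> norm (E x) * (2 * norm b)" by (intro mult_left_mono) auto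
    with le show ?case by linarith
  qed
  moreover have "((\<lambda>x. norm (E x) * (2 * norm b)) \<longlongrightarrow> 0) F"
    using tendsto_mult_left_zero[OF tendsto_norm_zero[OF E0]] .
  ultimately have "((\<lambda>x. B x - b) \<longlongrightarrow> 0) F"
    by (rule Lim_null_comparison)
  then show ?thesis by (simp add: LIM_zero_iff)
qed

section \<open>Isometric actions on Euclidean spaces\<close>

text \<open>An enumeration of the orthonormal \<open>Basis\<close> identifies \<open>'a\<close>
  isometrically with the coordinate space on which \<open>property_FR\<close> is stated. The
  application is to complex matrices, viewed as a real Euclidean space with the Frobenius
  metric.\<close>

lemma property_FR_fixed_point:
  fixes act :: "'g \<Rightarrow> 'a::euclidean_space \<Rightarrow> 'a"
  assumes G: "group G" and FR: "property_FR G"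
    and one: "\<And>x. act \<one>\<^bsub>G\<^esub> x = x"
    and mult: "\<And>g h x. g \<in> carrier G \<Longrightarrow> h \<in> carrier G \<Longrightarrow> act (g \<otimes>\<^bsub>G\<^esub> h) x = act g (act h x)"
    and iso: "\<And>g x y. g \<in> carrier G \<Longrightarrow> dist (act g x) (act g y) = dist x y"
  obtains x where "\<And>g. g \<in> carrier G \<Longrightarrow> act g x = x"
proof -
  interpret G: group G by (rule G)
  define m where "m = DIM('a)"
  define E where "E = topspace (Euclidean_space m)"
  obtain b :: "nat \<Rightarrow> 'a" where b: "bij_betw b {..<m} Basis"
    using ex_bij_betw_nat_finite[of "Basis :: 'a set"] by (auto simp: m_def atLeast0LessThan)
  define e where "e x = (\<Sum>i<m. x i *\<^sub>R b i)" for x :: "nat \<Rightarrow> real"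
  define f where "f y i = (if i < m then y \<bullet> b i else 0)" for y i
  have fE: "f y \<in> E" for y by (simp add: f_def E_def topspace_Euclidean_space)
  have ef: "e (f y) = y" for y
  proof -
    have "e (f y) = (\<Sum>i<m. (y \<bullet> b i) *\<^sub>R b i)" by (simp add: e_def f_def)
    also have "\<dots> = (\<Sum>u\<in>Basis. (y \<bullet> u) *\<^sub>R u)"
      by (rule sum.reindex_bij_betw[OF b, of "\<lambda>u. (y \<bullet> u) *\<^sub>R u"])
    finally show ?thesis by (simp add: euclidean_representation)
  qed
  have fe: "f (e x) = x" if "x \<in> E" for x
  proof
    fix i
    show "f (e x) i = x i"
    proof (cases "i < m")
      case True
      have bb: "b j \<bullet> b i = (if j = i then 1 else 0)" if "j < m" for j
      proof -
        have "b j \<in> Basis" "b i \<in> Basis" "b j = b i \<longleftrightarrow> j = i"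
          using that True b by (auto simp: bij_betw_def inj_on_def)
        then show ?thesis by (simp add: inner_Basis)
      qed
      have "e x \<bullet> b i = (\<Sum>j<m. x j * (if j = i then 1 else 0))"
        by (simp add: e_def inner_sum_left bb)
      then show ?thesis using True by (simp add: f_def if_distrib sum.delta cong: if_cong)
    qed (use that in \<open>auto simp: f_def E_def topspace_Euclidean_space\<close>)
  qed
  have fd: "euclid_dist m (f y) (f z) = dist y z" for y z
  proof -
    have "(\<Sum>i<m. ((y - z) \<bullet> b i)\<^sup>2) = (\<Sum>u\<in>Basis. ((y - z) \<bullet> u)\<^sup>2)"
      by (rule sum.reindex_bij_betw[OF b, of "\<lambda>u. ((y - z) \<bullet> u)\<^sup>2"])
    then show ?thesis
      by (simp add: euclid_dist_def f_def L2_set_def euclidean_dist_l2[of y z] dist_real_def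
          inner_diff_left)
  qed
  \<comment> \<open>\<open>BijGroup E\<close> consists of extensional bijections, hence the
    restriction.\<close>
  define \<phi> where "\<phi> g = restrict (\<lambda>x. f (act g (e x))) E" for g
  have \<phi>_mult: "\<phi> (g \<otimes>\<^bsub>G\<^esub> h) x = \<phi> g (\<phi> h x)" if "g \<in> carrier G" "h \<in> carrier G" "x \<in> E" for g h x
    using that by (simp add: \<phi>_def fE ef mult)
  have \<phi>_one: "\<phi> \<one>\<^bsub>G\<^esub> x = x" if "x \<in> E" for x
    using that by (simp add: \<phi>_def one fe)
  have \<phi>_E: "\<phi> g x \<in> E" if "x \<in> E" for g x
    using that by (simp add: \<phi>_def fE)
  have \<phi>_Bij: "\<phi> g \<in> Bij E" if g: "g \<in> carrier G" for g
  proof -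
    have "bij_betw (\<phi> g) E E"
      by (rule bij_betw_byWitness[where f' = "\<phi> (inv\<^bsub>G\<^esub> g)"])
        (auto simp: \<phi>_mult[symmetric] g \<phi>_one \<phi>_E)
    then show ?thesis by (simp add: Bij_def \<phi>_def)
  qed
  have "\<phi> \<in> hom G (BijGroup E)"
  proof (rule homI)
    show "\<phi> g \<in> carrier (BijGroup E)" if "g \<in> carrier G" for g
      using \<phi>_Bij[OF that] by (simp add: BijGroup_def)
    show "\<phi> (g \<otimes>\<^bsub>G\<^esub> h) = \<phi> g \<otimes>\<^bsub>BijGroup E\<^esub> \<phi> h" if "g \<in> carrier G" "h \<in> carrier G" for g h
    proof -
      have "\<phi> (g \<otimes>\<^bsub>G\<^esub> h) = compose E (\<phi> g) (\<phi> h)"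
      proof
        show "\<phi> (g \<otimes>\<^bsub>G\<^esub> h) x = compose E (\<phi> g) (\<phi> h) x" for x
          by (cases "x \<in> E") (use that in \<open>simp_all add: compose_def \<phi>_mult\<close>, simp add: \<phi>_def)
      qed
      then show ?thesis using that by (simp add: BijGroup_def \<phi>_Bij)
    qed
  qed
  then have "group_action G E \<phi>"
    by (simp add: group_action_def group_hom_def group_hom_axioms_def G group_BijGroup)
  moreover have "euclid_dist m (\<phi> g x) (\<phi> g y) = euclid_dist m x y"
    if "g \<in> carrier G" "x \<in> E" "y \<in> E" for g x y
    using that fd[of "e x" "e y"] by (simp add: \<phi>_def fd iso fe)
  ultimately have "isometric_action G m \<phi>"
    unfolding isometric_action_def E_def by blast
  then obtain x where x: "x \<in> E" "\<forall>g\<in>carrier G. \<phi> g x = x"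
    using FR unfolding property_FR_def E_def by blast
  show ?thesis
  proof (rule that)
    fix g assume "g \<in> carrier G"
    then have "f (act g (e x)) = x" using x by (auto simp: \<phi>_def)
    then show "act g (e x) = e x" using ef by metis
  qed
qed

section \<open>Gram matrices and matrices near the identity\<close>

lemma unitary_matrices_iff_gram: "A \<in> unitary_matrices \<longleftrightarrow> gram A = mat 1"
  unfolding unitary_matrices_def gram_def using matrix_left_right_inverse by blast

lemma adjoint_gram [simp]: "adjoint_matrix (gram A) = gram A"
  by (simp add: gram_def adjoint_matrix_mult)

lemma tendsto_gram:
  assumes "(A \<longlongrightarrow> a) F"
  shows "((\<lambda>x. gram (A x :: complex^'n^'n)) \<longlongrightarrow> gram a) F"
  unfolding gram_def by (intro mat_mult.tendsto tendsto_adjoint_matrix assms)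

lemma norm_mat_one_ge_1: "norm (mat 1 :: complex^'n^'n) \<ge> 1"
proof -
  have "norm (mat 1 :: complex^'n^'n) \<le> norm (mat 1 :: complex^'n^'n) * norm (mat 1 :: complex^'n^'n)"
    using norm_matrix_mult_le[of "mat 1 :: complex^'n^'n" "mat 1"] by simp
  moreover have "norm (mat 1 :: complex^'n^'n) > 0"
    by (simp add: vec_eq_iff mat_def)
  ultimately show ?thesis by simp
qed

text \<open>A kernel vector of \<open>B\<close>, repeated in every column, gives a matrix
  \<open>V\<close> with \<open>(mat 1 - B) ** V = V\<close>; since \<open>mat 1 - B\<close> has norm
  below 1, submultiplicativity forces \<open>V = 0\<close>.\<close>

lemma invertible_near_one:
  fixes B :: "complex^'n^'n"
  assumes "norm (B - mat 1) < 1"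
  obtains C where "B ** C = mat 1" "C ** B = mat 1"
proof -
  have "v = 0" if v: "B *v v = 0" for v
  proof -
    define V :: "complex^'n^'n" where "V = (\<chi> i j. v $ i)"
    have "B ** V = 0"
      using v by (simp add: vec_eq_iff V_def matrix_matrix_mult_def matrix_vector_mult_def)
    then have "(mat 1 - B) ** V = V" by (simp add: mat_mult.diff_left)
    then have le: "norm V \<le> norm (mat 1 - B) * norm V" by (metis norm_matrix_mult_le)
    have lt: "norm (mat 1 - B) < 1" using assms by (simp add: norm_minus_commute)
    have "\<not> norm V > 0"
    proof
      assume "norm V > 0"
      from mult_strict_right_mono[OF lt this] le show False by linarith
    qed
    then show ?thesis by (simp add: V_def vec_eq_iff)
  qed
  then obtain C where "C ** B = mat 1"
    using matrix_left_invertible_ker[of B] by auto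
  then show ?thesis using that matrix_left_right_inverse by blast
qed

text \<open>From \<open>C - mat 1 = (mat 1 - B) ** C\<close>, the factor 1/2 allows
  \<open>norm C\<close> to be absorbed into the left-hand side.\<close>

lemma norm_inverse_near_one:
  fixes B C :: "complex^'n^'n"
  assumes "norm (B - mat 1) \<le> 1/2" "B ** C = mat 1"
  shows "norm C \<le> 2 * norm (mat 1 :: complex^'n^'n)"
    and "norm (C - mat 1) \<le> 2 * norm (mat 1 :: complex^'n^'n) * norm (B - mat 1)"
proof -
  have "C - mat 1 = (mat 1 - B) ** C" using assms(2) by (simp add: mat_mult.diff_left)
  then have le: "norm (C - mat 1) \<le> norm (B - mat 1) * norm C"
    by (metis norm_matrix_mult_le norm_minus_commute)
  also have "\<dots> \<le> 1/2 * norm C" using assms(1) by (intro mult_right_mono) auto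
  finally show *: "norm C \<le> 2 * norm (mat 1 :: complex^'n^'n)"
    using norm_triangle_ineq2[of C "mat 1"] by linarith
  show "norm (C - mat 1) \<le> 2 * norm (mat 1 :: complex^'n^'n) * norm (B - mat 1)"
    using order_trans[OF le mult_left_mono[OF * norm_ge_zero]] by (simp add: mult.commute)
qed

section \<open>Representations and their conjugates\<close>

lemma hom_GL_mult:
  assumes "\<rho> \<in> hom G GL" "g \<in> carrier G" "h \<in> carrier G"
  shows "\<rho> (g \<otimes>\<^bsub>G\<^esub> h) = \<rho> g ** \<rho> h"
  using hom_mult[OF assms] by (simp add: GL_def)

lemma hom_GL_one:
  assumes "group G" "\<rho> \<in> hom G GL"
  shows "\<rho> \<one>\<^bsub>G\<^esub> = mat 1"
  using group_hom.hom_one[of G GL \<rho>] assms group_GL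
  by (simp add: group_hom_def group_hom_axioms_def GL_def)

lemma hom_GL_conj:
  fixes h h' :: "complex^'n^'n"
  assumes \<rho>: "\<rho> \<in> hom G GL" and h: "h ** h' = mat 1" "h' ** h = mat 1"
  shows "(\<lambda>g. h' ** \<rho> g ** h) \<in> hom G GL"
proof (rule homI)
  fix g assume "g \<in> carrier G"
  then have "invertible (\<rho> g)" using hom_in_carrier[OF \<rho>] by (simp add: GL_def)
  moreover have "invertible h" "invertible h'" using h by (auto simp: invertible_def)
  ultimately show "h' ** \<rho> g ** h \<in> carrier GL" by (simp add: GL_def invertible_mult)
next
  fix g k assume gk: "g \<in> carrier G" "k \<in> carrier G"
  have "h' ** \<rho> g ** h ** (h' ** \<rho> k ** h) = h' ** \<rho> g ** (h ** h') ** \<rho> k ** h"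
    by (simp add: matrix_mul_assoc)
  also have "\<dots> = h' ** \<rho> (g \<otimes>\<^bsub>G\<^esub> k) ** h"
    by (simp add: h hom_GL_mult[OF \<rho> gk] matrix_mul_assoc)
  finally show "h' ** \<rho> (g \<otimes>\<^bsub>G\<^esub> k) ** h = (h' ** \<rho> g ** h) \<otimes>\<^bsub>GL\<^esub> (h' ** \<rho> k ** h)"
    by (simp add: GL_def)
qed

section \<open>Rescaled defects and the limiting affine action\<close>

locale FR_group = group G for G (structure) +
  fixes S
  assumes finite_S: "finite S" and S_subset: "S \<subseteq> carrier G" and generate_S: "generate G S = carrier G"
    and FR: "property_FR G"
begin

lemma generators_induct:
  assumes g: "g \<in> carrier G" and one: "P \<one>" and gen: "\<And>s. s \<in> S \<Longrightarrow> P s"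
    and mult: "\<And>g h. g \<in> carrier G \<Longrightarrow> h \<in> carrier G \<Longrightarrow> P g \<Longrightarrow> P h \<Longrightarrow> P (g \<otimes> h)"
    and inv: "\<And>g. g \<in> carrier G \<Longrightarrow> P g \<Longrightarrow> P (inv g)"
  shows "P g"
proof -
  have "g \<in> carrier G \<and> P g" if "g \<in> generate G S" for g
    using that by induction (use S_subset in \<open>auto intro: one gen mult inv\<close>)
  with g generate_S show ?thesis by blast
qed

text \<open>The rescaled defects \<open>(\<rho>\<^sub>k(g) \<rho>\<^sub>k(g)\<^sup>* - 1) / e\<^sub>k\<close> satisfy the cocycle identity exactly, not only to first
  order, so no error accumulates along words in the generators. A fixed point \<open>Z\<close> of the limiting
  affine action tells how to move the base point so that the defect vanishes to first order.\<close>

lemma defect_limit: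
  fixes \<rho> :: "nat \<Rightarrow> 'a \<Rightarrow> complex^'n^'n" and e :: "nat \<Rightarrow> real"
  assumes \<rho>: "\<And>k. \<rho> k \<in> hom G GL" and e: "\<And>k. e k > 0" and e0: "e \<longlonglongrightarrow> 0"
    and defect: "\<And>k s. s \<in> S \<Longrightarrow> norm (gram (\<rho> k s) - mat 1) \<le> e k"
  obtains r :: "nat \<Rightarrow> nat" and Z :: "complex^'n^'n" where "strict_mono r"
    "\<And>s. s \<in> S \<Longrightarrow> (\<lambda>k. (1 / e (r k)) *\<^sub>R
        (\<rho> (r k) s ** gram (mat 1 + (e (r k) / 2) *\<^sub>R Z) ** adjoint_matrix (\<rho> (r k) s)
          - gram (mat 1 + (e (r k) / 2) *\<^sub>R Z))) \<longlonglongrightarrow> 0"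
proof -
  define b where "b k g = (1 / e k) *\<^sub>R (gram (\<rho> k g) - mat 1)" for k g
  have gram_b: "gram (\<rho> k g) = mat 1 + e k *\<^sub>R b k g" for k g
    using e[of k] by (simp add: b_def)
  have cocycle: "b k (g \<otimes> h) = \<rho> k g ** b k h ** adjoint_matrix (\<rho> k g) + b k g"
    if "g \<in> carrier G" "h \<in> carrier G" for k g h
    unfolding b_def hom_GL_mult[OF \<rho> that] gram_translate
    by (simp add: mat_mult.scaleR_left mat_mult.scaleR_right mat_mult.diff_left mat_mult.diff_right
        scaleR_right_diff_distrib gram_def)
  have b_one: "b k \<one> = 0" for k
    by (simp add: b_def hom_GL_one[OF is_group \<rho>] gram_def)
  have b_norm: "norm (b k s) \<le> 1" if "s \<in> S" for k s
    using defect[OF that, of k] e[of k] by (simp add: b_def)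
  obtain M where M: "\<And>k. e k \<le> M"
    using convergent_imp_Bseq[OF convergentI[OF e0]] unfolding Bseq_def
    by (metis abs_le_D1 real_norm_def)
  \<comment> \<open>The bound on the generators that \<open>norm_sq_le_norm_gram\<close> yields when
    the defects are at most \<open>M\<close>.\<close>
  define K where "K = sqrt (real CARD('n) * (norm (mat 1 :: complex^'n^'n) + M))"
  have \<rho>_norm: "norm (\<rho> k s) \<le> K" if "s \<in> S" for k s
  proof -
    have "norm (gram (\<rho> k s)) \<le> norm (mat 1 :: complex^'n^'n) + M"
      using defect[OF that, of k] M[of k] norm_triangle_ineq2[of "gram (\<rho> k s)" "mat 1"] by linarith
    then have "(norm (\<rho> k s))\<^sup>2 \<le> real CARD('n) * (norm (mat 1 :: complex^'n^'n) + M)"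
      using norm_sq_le_norm_gram[of "\<rho> k s"]
      by (meson mult_left_mono of_nat_0_le_iff order_trans)
    then show ?thesis unfolding K_def by (rule real_le_rsqrt)
  qed
  \<comment> \<open>Pairing the matrices with their rescaled defects lets one subsequence serve
    both, for all generators at once.\<close>
  have "norm (\<rho> k s, b k s) \<le> K + 1" if "s \<in> S" for k s
    using norm_Pair_le[of "\<rho> k s" "b k s"] \<rho>_norm[OF that, of k] b_norm[OF that, of k] by linarith
  then obtain r :: "nat \<Rightarrow> nat" where r: "strict_mono r"
    and conv: "\<And>s. s \<in> S \<Longrightarrow> \<exists>l. (\<lambda>k. (\<rho> (r k) s, b (r k) s)) \<longlonglongrightarrow> l"
    using function_convergent_subsequence[OF countable_finite[OF finite_S],
        of "\<lambda>k s. (\<rho> k s, b k s)" "K + 1"] by blast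
  have er0: "(\<lambda>k. e (r k)) \<longlonglongrightarrow> 0"
    using LIMSEQ_subseq_LIMSEQ[OF e0 r] by (simp add: o_def)
  \<comment> \<open>The defect is \<open>e k\<close> times the rescaled defect, so it tends to 0
    wherever the latter converges, not only at generators.\<close>
  have unitary_lim: "u \<in> unitary_matrices"
    if "(\<lambda>k. \<rho> (r k) g) \<longlonglongrightarrow> u" "(\<lambda>k. b (r k) g) \<longlonglongrightarrow> c" for g u c
  proof -
    have "(\<lambda>k. mat 1 + e (r k) *\<^sub>R b (r k) g) \<longlonglongrightarrow> mat 1 + 0 *\<^sub>R c"
      by (intro tendsto_intros er0 that)
    then have "gram u = mat 1"
      using LIMSEQ_unique[OF tendsto_gram[OF that(1)]] by (simp add: gram_b)
    then show ?thesis by (simp add: unitary_matrices_iff_gram)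
  qed
  \<comment> \<open>Convergence spreads from the generators to the whole group along the same
    subsequence, because products and inverses are given by exact formulas in \<open>\<rho>\<close>
    and \<open>b\<close>.\<close>
  have "\<exists>u c. (\<lambda>k. \<rho> (r k) g) \<longlonglongrightarrow> u \<and> (\<lambda>k. b (r k) g) \<longlonglongrightarrow> c" if "g \<in> carrier G" for g
    using that
  proof (rule generators_induct)
    show "\<exists>u c. (\<lambda>k. \<rho> (r k) \<one>) \<longlonglongrightarrow> u \<and> (\<lambda>k. b (r k) \<one>) \<longlonglongrightarrow> c"
      by (simp add: hom_GL_one[OF is_group \<rho>] b_one) (use tendsto_const in blast)
  next
    fix s assume "s \<in> S"
    then show "\<exists>u c. (\<lambda>k. \<rho> (r k) s) \<longlonglongrightarrow> u \<and> (\<lambda>k. b (r k) s) \<longlonglongrightarrow> c"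
      using conv tendsto_fst tendsto_snd by fastforce
  next
    fix g h assume gh: "g \<in> carrier G" "h \<in> carrier G"
    assume "\<exists>u c. (\<lambda>k. \<rho> (r k) g) \<longlonglongrightarrow> u \<and> (\<lambda>k. b (r k) g) \<longlonglongrightarrow> c"
      and "\<exists>u c. (\<lambda>k. \<rho> (r k) h) \<longlonglongrightarrow> u \<and> (\<lambda>k. b (r k) h) \<longlonglongrightarrow> c"
    then obtain u c u' c' where lim: "(\<lambda>k. \<rho> (r k) g) \<longlonglongrightarrow> u" "(\<lambda>k. b (r k) g) \<longlonglongrightarrow> c"
      "(\<lambda>k. \<rho> (r k) h) \<longlonglongrightarrow> u'" "(\<lambda>k. b (r k) h) \<longlonglongrightarrow> c'" by blast
    show "\<exists>u c. (\<lambda>k. \<rho> (r k) (g \<otimes> h)) \<longlonglongrightarrow> u \<and> (\<lambda>k. b (r k) (g \<otimes> h)) \<longlonglongrightarrow> c"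
      unfolding hom_GL_mult[OF \<rho> gh] cocycle[OF gh]
      by (intro exI[of _ "u ** u'"] exI[of _ "u ** c' ** adjoint_matrix u + c"] conjI tendsto_add
          mat_mult.tendsto tendsto_adjoint_matrix lim)
  next
    fix g assume g: "g \<in> carrier G"
    assume "\<exists>u c. (\<lambda>k. \<rho> (r k) g) \<longlonglongrightarrow> u \<and> (\<lambda>k. b (r k) g) \<longlonglongrightarrow> c"
    then obtain u c where u: "(\<lambda>k. \<rho> (r k) g) \<longlonglongrightarrow> u" and c: "(\<lambda>k. b (r k) g) \<longlonglongrightarrow> c" by blast
    have "\<rho> k g ** \<rho> k (inv g) = mat 1" for k
      using hom_GL_mult[OF \<rho>, of g "inv g" k] g hom_GL_one[OF is_group \<rho>] by simp
    \<comment> \<open>The limit \<open>u\<close> is already known to be unitary, so its adjoint is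
      the limit to expect for the inverses.\<close>
    then have u': "(\<lambda>k. \<rho> (r k) (inv g)) \<longlonglongrightarrow> adjoint_matrix u"
      using unitary_lim[OF u c]
      by (intro tendsto_right_inverse_matrix[OF u]) (auto simp: unitary_matrices_def)
    \<comment> \<open>The cocycle identity for the product of \<open>inv g\<close> and
      \<open>g\<close>, where \<open>b\<close> vanishes at the neutral element.\<close>
    have "b k (inv g) = - (\<rho> k (inv g) ** b k g ** adjoint_matrix (\<rho> k (inv g)))" for k
      using cocycle[of "inv g" g k] g b_one[of k] by (simp add: eq_neg_iff_add_eq_0 add.commute)
    then show "\<exists>u c. (\<lambda>k. \<rho> (r k) (inv g)) \<longlonglongrightarrow> u \<and> (\<lambda>k. b (r k) (inv g)) \<longlonglongrightarrow> c"
      using tendsto_minus[OF mat_mult.tendsto[OF mat_mult.tendsto[OF u' c]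
            tendsto_adjoint_matrix[OF u']]] u' by auto
  qed
  then obtain u c where u: "\<And>g. g \<in> carrier G \<Longrightarrow> (\<lambda>k. \<rho> (r k) g) \<longlonglongrightarrow> u g"
    and c: "\<And>g. g \<in> carrier G \<Longrightarrow> (\<lambda>k. b (r k) g) \<longlonglongrightarrow> c g"
    by metis
  have u_unitary: "u g \<in> unitary_matrices" if "g \<in> carrier G" for g
    using unitary_lim u c that by blast
  have u_mult: "u (g \<otimes> h) = u g ** u h"
    and c_mult: "c (g \<otimes> h) = u g ** c h ** adjoint_matrix (u g) + c g"
    if gh: "g \<in> carrier G" "h \<in> carrier G" for g h
  proof -
    show "u (g \<otimes> h) = u g ** u h"
      using LIMSEQ_unique[OF u[OF m_closed[OF gh], unfolded hom_GL_mult[OF \<rho> gh]]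
          mat_mult.tendsto[OF u u]] gh by blast
    show "c (g \<otimes> h) = u g ** c h ** adjoint_matrix (u g) + c g"
      by (rule LIMSEQ_unique[OF c[OF m_closed[OF gh], unfolded cocycle[OF gh]]])
        (intro tendsto_intros mat_mult.tendsto tendsto_adjoint_matrix u c gh)
  qed
  have c_herm: "adjoint_matrix (c g) = c g" if "g \<in> carrier G" for g
  proof -
    have "adjoint_matrix (b k g) = b k g" for k
      by (simp add: b_def adjoint_matrix_scaleR adjoint_matrix_diff)
    then show ?thesis
      using LIMSEQ_unique[OF tendsto_adjoint_matrix[OF c[OF that]]] c[OF that] by simp
  qed
  have u_one: "u \<one> = mat 1"
    using LIMSEQ_unique[OF u[OF one_closed]] by (simp add: hom_GL_one[OF is_group \<rho>])
  have c_one: "c \<one> = 0"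
    using LIMSEQ_unique[OF c[OF one_closed]] by (simp add: b_one)
  \<comment> \<open>The cocycle identity for \<open>c\<close> makes this an action, and unitarity of
    \<open>u g\<close> makes it isometric.\<close>
  obtain W where W: "\<And>g. g \<in> carrier G \<Longrightarrow> u g ** W ** adjoint_matrix (u g) + c g = W"
  proof (rule property_FR_fixed_point[OF is_group FR,
        of "\<lambda>g W. u g ** W ** adjoint_matrix (u g) + c g"])
    show "u \<one> ** W ** adjoint_matrix (u \<one>) + c \<one> = W" for W
      by (simp add: u_one c_one)
    show "u (g \<otimes> h) ** W ** adjoint_matrix (u (g \<otimes> h)) + c (g \<otimes> h)
        = u g ** (u h ** W ** adjoint_matrix (u h) + c h) ** adjoint_matrix (u g) + c g"
      if "g \<in> carrier G" "h \<in> carrier G" for g h W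
      by (simp add: u_mult c_mult that adjoint_matrix_mult matrix_mul_assoc mat_mult.add_left
          mat_mult.add_right)
    show "dist (u g ** V ** adjoint_matrix (u g) + c g) (u g ** W ** adjoint_matrix (u g) + c g) = dist V W"
      if "g \<in> carrier G" for g V W
      using norm_conj_unitary[OF u_unitary[OF that], of "V - W"]
      by (simp add: dist_norm mat_mult.diff_left mat_mult.diff_right)
  qed blast
  \<comment> \<open>Since \<open>c g\<close> is Hermitian, the adjoint of a fixed point is again a
    fixed point, and so is the midpoint of the two.\<close>
  define Z where "Z = (1/2) *\<^sub>R (W + adjoint_matrix W)"
  have Z_herm: "adjoint_matrix Z = Z"
    by (simp add: Z_def adjoint_matrix_scaleR adjoint_matrix_add add.commute)
  have Z_fix: "c g + (u g ** Z ** adjoint_matrix (u g) - Z) = 0" if g: "g \<in> carrier G" for g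
  proof -
    have "u g ** adjoint_matrix W ** adjoint_matrix (u g) + c g = adjoint_matrix W"
      using arg_cong[OF W[OF g], of adjoint_matrix]
      by (simp add: adjoint_matrix_add adjoint_matrix_mult matrix_mul_assoc c_herm[OF g])
    moreover have "u g ** (W + adjoint_matrix W) ** adjoint_matrix (u g) + 2 *\<^sub>R c g
        = (u g ** W ** adjoint_matrix (u g) + c g)
          + (u g ** adjoint_matrix W ** adjoint_matrix (u g) + c g)"
      by (simp add: mat_mult.add_left mat_mult.add_right scaleR_2)
    ultimately have "u g ** (W + adjoint_matrix W) ** adjoint_matrix (u g) + 2 *\<^sub>R c g = W + adjoint_matrix W"
      by (simp only: W[OF g])
    then have "(1/2) *\<^sub>R (u g ** (W + adjoint_matrix W) ** adjoint_matrix (u g) + 2 *\<^sub>R c g) = Z"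
      by (simp add: Z_def)
    then show ?thesis
      by (simp add: Z_def mat_mult.scaleR_left mat_mult.scaleR_right scaleR_right_distrib
          mat_mult.add_left mat_mult.add_right algebra_simps)
  qed
  \<comment> \<open>As \<open>Z\<close> is Hermitian, this is the square of the matrix. The linear
    coefficient doubles, which is why the base point is moved with \<open>e k / 2\<close>.\<close>
  have gram_Z: "gram (mat 1 + t *\<^sub>R Z) = mat 1 + (t + t) *\<^sub>R Z + t\<^sup>2 *\<^sub>R (Z ** Z)" for t
    unfolding gram_def adjoint_matrix_add adjoint_matrix_scaleR Z_herm adjoint_matrix_one
      mat_mult.add_left mat_mult.add_right mat_mult.scaleR_left mat_mult.scaleR_right
      scaleR_left_distrib power2_eq_square
    by (simp only: matrix_mul_lid matrix_mul_rid scaleR_right_distrib scaleR_scaleR add.assoc)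
  \<comment> \<open>The first two summands tend to the left-hand side of \<open>Z_fix\<close>, which
    is 0. The last carries the coefficient \<open>(e k / 2)\<^sup>2 / e k\<close>, which tends to 0
    while the matrix next to it converges.\<close>
  have expand: "(1 / e k) *\<^sub>R (\<rho> k s ** gram (mat 1 + (e k / 2) *\<^sub>R Z) ** adjoint_matrix (\<rho> k s)
        - gram (mat 1 + (e k / 2) *\<^sub>R Z))
      = b k s + (\<rho> k s ** Z ** adjoint_matrix (\<rho> k s) - Z)
        + (e k / 4) *\<^sub>R (\<rho> k s ** (Z ** Z) ** adjoint_matrix (\<rho> k s) - Z ** Z)" for k s
  proof -
    define T where "T A = \<rho> k s ** A ** adjoint_matrix (\<rho> k s)" for A
    have T_gram: "T (gram (mat 1 + (e k / 2) *\<^sub>R Z))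
        = T (mat 1) + e k *\<^sub>R T Z + (e k / 2)\<^sup>2 *\<^sub>R T (Z ** Z)"
      unfolding gram_Z T_def field_sum_of_halves
      by (simp add: mat_mult.add_left mat_mult.add_right mat_mult.scaleR_left mat_mult.scaleR_right)
    have coeff: "1 / e k * e k = 1" "1 / e k * (e k / 2)\<^sup>2 = e k / 4"
      using e[of k] by (simp_all add: power2_eq_square)
    have "(1 / e k) *\<^sub>R (T (gram (mat 1 + (e k / 2) *\<^sub>R Z)) - gram (mat 1 + (e k / 2) *\<^sub>R Z))
        = (1 / e k) *\<^sub>R (T (mat 1) - mat 1) + (1 / e k * e k) *\<^sub>R (T Z - Z)
          + (1 / e k * (e k / 2)\<^sup>2) *\<^sub>R (T (Z ** Z) - Z ** Z)"
      unfolding T_gram unfolding gram_Z field_sum_of_halves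
      by (simp only: scaleR_right_distrib scaleR_right_diff_distrib scaleR_scaleR) simp
    then show ?thesis
      unfolding coeff by (simp add: T_def b_def gram_def[of "\<rho> k s"])
  qed
  show ?thesis
  proof (rule that[OF r])
    fix s assume "s \<in> S"
    then have s: "s \<in> carrier G" using S_subset by blast
    have "(\<lambda>k. b (r k) s + (\<rho> (r k) s ** Z ** adjoint_matrix (\<rho> (r k) s) - Z)
        + (e (r k) / 4) *\<^sub>R (\<rho> (r k) s ** (Z ** Z) ** adjoint_matrix (\<rho> (r k) s) - Z ** Z))
      \<longlonglongrightarrow> c s + (u s ** Z ** adjoint_matrix (u s) - Z)
        + (0 / 4) *\<^sub>R (u s ** (Z ** Z) ** adjoint_matrix (u s) - Z ** Z)"
      by (intro tendsto_intros mat_mult.tendsto tendsto_adjoint_matrix u c s er0) auto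
    then show "(\<lambda>k. (1 / e (r k)) *\<^sub>R
        (\<rho> (r k) s ** gram (mat 1 + (e (r k) / 2) *\<^sub>R Z) ** adjoint_matrix (\<rho> (r k) s)
          - gram (mat 1 + (e (r k) / 2) *\<^sub>R Z))) \<longlonglongrightarrow> 0"
      by (simp add: expand Z_fix[OF s])
  qed
qed

end

section \<open>Halving the defects and iterating\<close>

context FR_group
begin

text \<open>\<open>C\<close> and \<open>\<eta>\<close> are uniform over all representations of the
  given dimension; they come from a compactness argument and are not explicit. The linear bound
  \<open>C * e\<close> makes the corrections summable when \<open>e\<close> is halved
  repeatedly.\<close>

lemma defect_contraction:
  "\<exists>C \<eta>. 0 < \<eta> \<and> (\<forall>(\<rho> :: 'a \<Rightarrow> complex^'n^'n) e.
      \<rho> \<in> hom G GL \<and> 0 < e \<and> e \<le> \<eta> \<and> (\<forall>s\<in>S. norm (gram (\<rho> s) - mat 1) \<le> e) \<longrightarrow>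
      (\<exists>B B'. B ** B' = mat 1 \<and> B' ** B = mat 1 \<and> norm (B - mat 1) \<le> C * e \<and>
        norm (B' - mat 1) \<le> C * e \<and> (\<forall>s\<in>S. norm (gram (B' ** \<rho> s ** B) - mat 1) \<le> e / 2)))"
proof (rule ccontr)
  define contracts where "contracts C \<rho> e \<longleftrightarrow>
      (\<exists>B B'. B ** B' = mat 1 \<and> B' ** B = mat 1 \<and> norm (B - mat 1) \<le> C * e \<and>
        norm (B' - mat 1) \<le> C * e \<and> (\<forall>s\<in>S. norm (gram (B' ** \<rho> s ** B) - mat 1) \<le> e / 2))"
    for C e and \<rho> :: "'a \<Rightarrow> complex^'n^'n"
  assume "\<not> ?thesis"
  then have "\<exists>(\<rho> :: 'a \<Rightarrow> complex^'n^'n) e. \<rho> \<in> hom G GL \<and> 0 < e \<and> e \<le> \<eta> \<and>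
      (\<forall>s\<in>S. norm (gram (\<rho> s) - mat 1) \<le> e) \<and> \<not> contracts C \<rho> e" if "\<eta> > 0" for C \<eta>
    using that unfolding contracts_def[symmetric] by blast
  \<comment> \<open>Failure is used with \<open>C = k\<close> and threshold
    \<open>1 / (k + 1)\<close> simultaneously: the defects tend to 0 while the permitted distance
    from the identity, relative to \<open>e\<close>, grows without bound.\<close>
  then have "\<exists>\<rho> e. \<rho> \<in> hom G GL \<and> 0 < e \<and> e \<le> inverse (real (Suc k)) \<and>
      (\<forall>s\<in>S. norm (gram (\<rho> s) - mat 1) \<le> e) \<and> \<not> contracts (real k) \<rho> e" for k
    by simp
  then obtain \<rho> e where \<rho>: "\<And>k. \<rho> k \<in> hom G GL" and e: "\<And>k. 0 < e k"
    and e_le: "\<And>k. e k \<le> inverse (real (Suc k))"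
    and defect: "\<And>k s. s \<in> S \<Longrightarrow> norm (gram (\<rho> k s) - mat 1) \<le> e k"
    and not_contr: "\<And>k. \<not> contracts (real k) (\<rho> k) (e k)"
    by metis
  have e0: "e \<longlonglongrightarrow> 0"
    by (rule tendsto_sandwich[OF _ _ tendsto_const LIMSEQ_inverse_real_of_nat])
      (use e e_le in \<open>auto intro!: always_eventually less_imp_le\<close>)
  obtain r Z where r: "strict_mono r" and lim: "\<And>s. s \<in> S \<Longrightarrow> (\<lambda>k. (1 / e (r k)) *\<^sub>R
        (\<rho> (r k) s ** gram (mat 1 + (e (r k) / 2) *\<^sub>R Z) ** adjoint_matrix (\<rho> (r k) s)
          - gram (mat 1 + (e (r k) / 2) *\<^sub>R Z))) \<longlonglongrightarrow> 0"
    using defect_limit[OF \<rho> e e0 defect] by blast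
  define c where "c = norm (mat 1 :: complex^'n^'n)"
  have c1: "c \<ge> 1" unfolding c_def by (rule norm_mat_one_ge_1)
  define B where "B k = mat 1 + (e (r k) / 2) *\<^sub>R Z" for k
  define D where "D k s = \<rho> (r k) s ** gram (B k) ** adjoint_matrix (\<rho> (r k) s) - gram (B k)" for k s
  have B_norm: "norm (B k - mat 1) = e (r k) / 2 * norm Z" for k
    using e[of "r k"] by (simp add: B_def)
  have "(\<lambda>k. e (r k)) \<longlonglongrightarrow> 0"
    using LIMSEQ_subseq_LIMSEQ[OF e0 r] by (simp add: o_def)
  then have "(\<lambda>k. e (r k) / 2 * norm Z) \<longlonglongrightarrow> 0 / 2 * norm Z"
    by (intro tendsto_intros) auto
  then have ev1: "\<forall>\<^sub>F k in sequentially. norm (B k - mat 1) < 1/2"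
    unfolding B_norm by (rule order_tendstoD) simp
  \<comment> \<open>Conjugation by the inverse of \<open>B k\<close>, of norm at most
    \<open>2 * c\<close>, costs a factor \<open>4 * c\<^sup>2\<close>; with this threshold the new
    defect is at most \<open>e (r k) / 2\<close>.\<close>
  have ev2: "\<forall>\<^sub>F k in sequentially. \<forall>s\<in>S. norm ((1 / e (r k)) *\<^sub>R D k s) < 1 / (8 * c\<^sup>2)"
  proof (rule eventually_ball_finite[OF finite_S], rule ballI)
    fix s assume "s \<in> S"
    then have "(\<lambda>k. norm ((1 / e (r k)) *\<^sub>R D k s)) \<longlonglongrightarrow> 0"
      using lim unfolding D_def B_def by (intro tendsto_norm_zero)
    moreover have "0 < 1 / (8 * c\<^sup>2)"
      using c1 by simp
    ultimately show "\<forall>\<^sub>F k in sequentially. norm ((1 / e (r k)) *\<^sub>R D k s) < 1 / (8 * c\<^sup>2)"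
      by (rule order_tendstoD)
  qed
  have ev3: "\<forall>\<^sub>F k in sequentially. norm Z * c \<le> real k"
    by (rule eventually_sequentiallyI[of "nat \<lceil>norm Z * c\<rceil>"]) linarith
  obtain k where k: "norm (B k - mat 1) < 1/2" "norm Z * c \<le> real k"
    "\<And>s. s \<in> S \<Longrightarrow> norm ((1 / e (r k)) *\<^sub>R D k s) < 1 / (8 * c\<^sup>2)"
    using eventually_happens'[OF sequentially_bot eventually_conj[OF ev1 eventually_conj[OF ev2 ev3]]]
    by blast
  \<comment> \<open>The constant to be refuted is that of the original index,
    \<open>real (r k)\<close>, and \<open>k \<le> r k\<close>.\<close>
  have k': "norm Z * c \<le> real (r k)"
    using k(2) seq_suble[OF r, of k] by linarith
  obtain B' where B': "B k ** B' = mat 1" "B' ** B k = mat 1"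
    using invertible_near_one[of "B k"] k(1) by auto
  note B'_norm = norm_inverse_near_one[OF less_imp_le[OF k(1)] B'(1), folded c_def]
  have "norm Z / 2 \<le> norm Z * c"
    using c1 mult_left_mono[of "1/2" c "norm Z"] by simp
  then have "e (r k) * (norm Z / 2) \<le> e (r k) * real (r k)"
    using k' e[of "r k"] by (intro mult_left_mono) auto
  then have "norm (B k - mat 1) \<le> real (r k) * e (r k)"
    unfolding B_norm by (simp add: mult.commute)
  moreover have "norm (B' - mat 1) \<le> real (r k) * e (r k)"
  proof -
    have "norm (B' - mat 1) \<le> (norm Z * c) * e (r k)"
      using B'_norm(2) unfolding B_norm by (simp add: mult_ac)
    also have "\<dots> \<le> real (r k) * e (r k)"
      using k' e[of "r k"] by (intro mult_right_mono) auto
    finally show ?thesis .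
  qed
  moreover have "norm (gram (B' ** \<rho> (r k) s ** B k) - mat 1) \<le> e (r k) / 2" if s: "s \<in> S" for s
  proof -
    \<comment> \<open>Writing the identity as \<open>B' ** gram (B k) ** adjoint_matrix B'\<close>
      exhibits the new defect as a conjugate of \<open>D k s\<close>.\<close>
    have "gram (B' ** B k) = mat 1" by (simp add: B' gram_def)
    then have "gram (B' ** \<rho> (r k) s ** B k) - mat 1 = B' ** D k s ** adjoint_matrix B'"
      by (simp add: D_def gram_translate mat_mult.diff_left mat_mult.diff_right
          adjoint_matrix_mult matrix_mul_assoc)
    also have "norm \<dots> \<le> norm B' * norm (D k s) * norm B'"
      by (rule order_trans[OF norm_matrix_mult_le])
        (simp add: norm_matrix_mult_le mult_right_mono)
    also have "\<dots> \<le> (2 * c) * norm (D k s) * (2 * c)"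
      using B'_norm(1) c1 by (intro mult_mono) auto
    also have "\<dots> = 4 * c\<^sup>2 * norm (D k s)"
      by (simp add: power2_eq_square)
    also have "norm (D k s) \<le> e (r k) / (8 * c\<^sup>2)"
      using k(3)[OF s] e[of "r k"] c1 by (simp add: field_simps)
    then have "4 * c\<^sup>2 * norm (D k s) \<le> 4 * c\<^sup>2 * (e (r k) / (8 * c\<^sup>2))"
      by (rule mult_left_mono) simp
    also have "\<dots> = e (r k) / 2" using c1 by simp
    finally show ?thesis .
  qed
  ultimately have "contracts (real (r k)) (\<rho> (r k)) (e (r k))"
    unfolding contracts_def using B' by blast
  with not_contr show False by blast
qed

text \<open>The contraction is applied with \<open>e = \<eta> / 2 ^ i\<close> to the representation
  conjugated so far. Bounding the accumulated conjugators and also their inverses keeps the limit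
  point invertible.\<close>

lemma small_defect_unitarizable:
  "\<exists>\<eta>>0. \<forall>\<rho> :: 'a \<Rightarrow> complex^'n^'n. \<rho> \<in> hom G GL \<and> (\<forall>s\<in>S. norm (gram (\<rho> s) - mat 1) \<le> \<eta>) \<longrightarrow>
     (\<exists>(h :: complex^'n^'n) h'. h ** h' = mat 1 \<and> h' ** h = mat 1 \<and> (\<forall>g\<in>carrier G. h' ** \<rho> g ** h \<in> unitary_matrices))"
proof -
  obtain C \<eta> where \<eta>: "\<eta> > 0" and contr: "\<And>(\<rho> :: 'a \<Rightarrow> complex^'n^'n) e.
      \<rho> \<in> hom G GL \<Longrightarrow> 0 < e \<Longrightarrow> e \<le> \<eta> \<Longrightarrow> (\<And>s. s \<in> S \<Longrightarrow> norm (gram (\<rho> s) - mat 1) \<le> e) \<Longrightarrow>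
      \<exists>B B'. B ** B' = mat 1 \<and> B' ** B = mat 1 \<and> norm (B - mat 1) \<le> C * e \<and>
        norm (B' - mat 1) \<le> C * e \<and> (\<forall>s\<in>S. norm (gram (B' ** \<rho> s ** B) - mat 1) \<le> e / 2)"
    using defect_contraction[where 'n = 'n] by blast
  show ?thesis
  proof (intro exI[of _ \<eta>] conjI \<eta> allI impI, elim conjE)
    fix \<rho> :: "'a \<Rightarrow> complex^'n^'n"
    assume \<rho>: "\<rho> \<in> hom G GL" and defect: "\<forall>s\<in>S. norm (gram (\<rho> s) - mat 1) \<le> \<eta>"
    define c where "c = norm (mat 1 :: complex^'n^'n)"
    \<comment> \<open>\<open>a i\<close> is the sum of the first \<open>i\<close> step sizes \<open>C \<eta> / 2 ^ j\<close>.\<close>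
    define a where "a i = C * \<eta> * (2 - 2 / 2 ^ i)" for i :: nat
    \<comment> \<open>By \<open>1 + x \<le> exp x\<close>, the product of the growth factors is at
      most the exponential of the sum of the step sizes; \<open>c\<close> is the norm of the initial
      conjugator \<open>mat 1\<close>.\<close>
    have growth: "norm h + norm h * norm (B - mat 1) \<le> c * exp (a (Suc i))"
      if h: "norm h \<le> c * exp (a i)" and B: "norm (B - mat 1) \<le> C * (\<eta> / 2 ^ i)"
      for h B :: "complex^'n^'n" and i
    proof -
      have "norm h + norm h * norm (B - mat 1) = norm h * (1 + norm (B - mat 1))"
        by (simp add: distrib_left)
      also have "\<dots> \<le> norm h * exp (norm (B - mat 1))"
        by (intro mult_left_mono) auto
      also have "\<dots> \<le> (c * exp (a i)) * exp (C * (\<eta> / 2 ^ i))"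
        using B by (intro mult_mono h) (auto simp: c_def)
      also have "\<dots> = c * exp (a (Suc i))"
        by (simp add: a_def mult.assoc exp_add[symmetric] field_simps)
      finally show ?thesis .
    qed
    have right: "norm (h ** B) \<le> norm h + norm h * norm (B - mat 1)"
      and left: "norm (B ** h) \<le> norm h + norm h * norm (B - mat 1)" for h B :: "complex^'n^'n"
    proof -
      have "h ** B = h + h ** (B - mat 1)" "B ** h = h + (B - mat 1) ** h"
        by (simp_all add: mat_mult.diff_left mat_mult.diff_right)
      then show "norm (h ** B) \<le> norm h + norm h * norm (B - mat 1)"
        "norm (B ** h) \<le> norm h + norm h * norm (B - mat 1)"
        by (metis add_left_mono norm_matrix_mult_le norm_triangle_le,
            metis add_left_mono norm_matrix_mult_le norm_triangle_le mult.commute)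
    qed
    have "\<exists>(h :: complex^'n^'n) h'. h ** h' = mat 1 \<and> h' ** h = mat 1 \<and> norm h \<le> c * exp (a i) \<and> norm h' \<le> c * exp (a i) \<and>
        (\<forall>s\<in>S. norm (gram (h' ** \<rho> s ** h) - mat 1) \<le> \<eta> / 2 ^ i)" for i
    proof (induction i)
      case 0
      show ?case
        by (intro exI[of _ "mat 1 :: complex^'n^'n"]) (use defect in \<open>simp add: c_def a_def\<close>)
    next
      case (Suc i)
      then obtain h h' :: "complex^'n^'n" where h: "h ** h' = mat 1" "h' ** h = mat 1"
        and bd: "norm h \<le> c * exp (a i)" "norm h' \<le> c * exp (a i)"
        and d: "\<And>s. s \<in> S \<Longrightarrow> norm (gram (h' ** \<rho> s ** h) - mat 1) \<le> \<eta> / 2 ^ i" by blast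
      have "\<eta> / 2 ^ i \<le> \<eta>" using \<eta> by (simp add: field_simps)
      then obtain B B' where B: "B ** B' = mat 1" "B' ** B = mat 1"
        and Bn: "norm (B - mat 1) \<le> C * (\<eta> / 2 ^ i)" "norm (B' - mat 1) \<le> C * (\<eta> / 2 ^ i)"
        and d': "\<And>s. s \<in> S \<Longrightarrow> norm (gram (B' ** (h' ** \<rho> s ** h) ** B) - mat 1) \<le> \<eta> / 2 ^ i / 2"
        using contr[OF hom_GL_conj[OF \<rho> h], of "\<eta> / 2 ^ i"] \<eta> d by auto
      have "h ** B ** (B' ** h') = h ** (B ** B') ** h'" "B' ** h' ** (h ** B) = B' ** (h' ** h) ** B"
        by (simp_all add: matrix_mul_assoc)
      then have inv: "h ** B ** (B' ** h') = mat 1" "B' ** h' ** (h ** B) = mat 1"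
        by (simp_all add: B h)
      have "norm (h ** B) \<le> c * exp (a (Suc i))" "norm (B' ** h') \<le> c * exp (a (Suc i))"
        using order_trans[OF right growth[OF bd(1) Bn(1)]] order_trans[OF left growth[OF bd(2) Bn(2)]]
        by auto
      moreover have "norm (gram (B' ** h' ** \<rho> s ** (h ** B)) - mat 1) \<le> \<eta> / 2 ^ Suc i" if "s \<in> S" for s
        using d'[OF that] by (simp add: matrix_mul_assoc mult.commute)
      ultimately show ?case using inv by blast
    qed
    then obtain h h' :: "nat \<Rightarrow> complex^'n^'n" where h: "\<And>i. h i ** h' i = mat 1" "\<And>i. h' i ** h i = mat 1"
      and bd: "\<And>i. norm (h i) \<le> c * exp (a i)" "\<And>i. norm (h' i) \<le> c * exp (a i)"
      and d: "\<And>i s. s \<in> S \<Longrightarrow> norm (gram (h' i ** \<rho> s ** h i) - mat 1) \<le> \<eta> / 2 ^ i"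
      by metis
    \<comment> \<open>The contraction lemma does not give the sign of \<open>C\<close>, hence the
      absolute value.\<close>
    have "a i \<le> \<bar>C * \<eta>\<bar> * 2" for i
    proof -
      have "a i \<le> \<bar>C * \<eta>\<bar> * (2 - 2 / 2 ^ i)"
        unfolding a_def by (intro mult_right_mono) (auto simp: field_simps)
      also have "\<dots> \<le> \<bar>C * \<eta>\<bar> * 2" by (intro mult_left_mono) auto
      finally show ?thesis .
    qed
    then have "c * exp (a i) \<le> c * exp (\<bar>C * \<eta>\<bar> * 2)" for i
      by (intro mult_left_mono) (auto simp: c_def)
    then have "norm (h i) \<le> c * exp (\<bar>C * \<eta>\<bar> * 2)" "norm (h' i) \<le> c * exp (\<bar>C * \<eta>\<bar> * 2)" for i
      using bd order_trans by blast+
    then have "norm (h i, h' i) \<le> c * exp (\<bar>C * \<eta>\<bar> * 2) + c * exp (\<bar>C * \<eta>\<bar> * 2)" for i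
      by (meson add_mono norm_Pair_le order_trans)
    \<comment> \<open>Extracting from the pairs makes both factors converge along one subsequence,
      so the inverse relations pass to the limit.\<close>
    then have "bounded (range (\<lambda>i. (h i, h' i)))" by (auto simp: bounded_iff)
    then obtain l r where r: "strict_mono (r :: nat \<Rightarrow> nat)" and l: "((\<lambda>i. (h i, h' i)) \<circ> r) \<longlonglongrightarrow> l"
      using bounded_imp_convergent_subsequence by blast
    obtain H H' where HH: "l = (H, H')" by (cases l)
    have H: "(\<lambda>i. h (r i)) \<longlonglongrightarrow> H" and H': "(\<lambda>i. h' (r i)) \<longlonglongrightarrow> H'"
      using tendsto_fst[OF l] tendsto_snd[OF l] by (simp_all add: HH o_def)
    have inv: "H ** H' = mat 1" "H' ** H = mat 1"
      using LIMSEQ_unique[OF mat_mult.tendsto[OF H H']] LIMSEQ_unique[OF mat_mult.tendsto[OF H' H]]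
      by (simp_all add: h)
    define \<sigma> where "\<sigma> g = H' ** \<rho> g ** H" for g
    have \<sigma>: "\<sigma> \<in> hom G GL" unfolding \<sigma>_def by (rule hom_GL_conj[OF \<rho> inv])
    have \<sigma>_S: "\<sigma> s \<in> unitary_matrices" if s: "s \<in> S" for s
    proof -
      have "(\<lambda>i. norm (gram (h' (r i) ** \<rho> s ** h (r i)) - mat 1)) \<longlonglongrightarrow> norm (gram (\<sigma> s) - mat 1)"
        unfolding \<sigma>_def by (intro tendsto_intros tendsto_gram mat_mult.tendsto H H')
      moreover have "(\<lambda>i. \<eta> / 2 ^ r i) \<longlonglongrightarrow> 0"
        using LIMSEQ_subseq_LIMSEQ[OF LIMSEQ_divide_realpow_zero[of 2 \<eta>] r] by (simp add: o_def)
      ultimately have "norm (gram (\<sigma> s) - mat 1) \<le> 0"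
        by (rule LIMSEQ_le) (use d s in blast)
      then show ?thesis by (simp add: unitary_matrices_iff_gram)
    qed
    have "\<sigma> g \<in> unitary_matrices" if "g \<in> carrier G" for g
      using that
    proof (rule generators_induct)
      show "\<sigma> \<one> \<in> unitary_matrices"
        by (simp add: hom_GL_one[OF is_group \<sigma>] unitary_matrices_def)
      show "\<sigma> (g \<otimes> k) \<in> unitary_matrices"
        if "g \<in> carrier G" "k \<in> carrier G" "\<sigma> g \<in> unitary_matrices" "\<sigma> k \<in> unitary_matrices" for g k
        using subgroup.m_closed[OF subgroup_U that(3,4)]
        by (simp add: hom_GL_mult[OF \<sigma> that(1,2)] GL_def)
      show "\<sigma> (inv g) \<in> unitary_matrices" if "g \<in> carrier G" "\<sigma> g \<in> unitary_matrices" for g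
      proof -
        have "\<sigma> (inv g) = inv\<^bsub>GL\<^esub> \<sigma> g"
          using that \<sigma> group_hom.hom_inv[of G GL \<sigma> g]
          by (simp add: group_hom_def group_hom_axioms_def is_group group_GL)
        then show ?thesis using subgroup.m_inv_closed[OF subgroup_U that(2)] by simp
      qed
    qed (rule \<sigma>_S)
    then show "\<exists>(h :: complex^'n^'n) h'. h ** h' = mat 1 \<and> h' ** h = mat 1 \<and> (\<forall>g\<in>carrier G. h' ** \<rho> g ** h \<in> unitary_matrices)"
      using inv unfolding \<sigma>_def by blast
  qed
qed

end

section \<open>Hermitian forms and positive definite matrices\<close>

lemma norm_matrix_vector_mult_le: "norm (A *v x) \<le> norm (A :: complex^'n^'n) * norm x"
proof -
  have "(norm (A *v x))\<^sup>2 = (\<Sum>i\<in>UNIV. (cmod (\<Sum>k\<in>UNIV. A $ i $ k * x $ k))\<^sup>2)"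
    by (simp add: norm_vec_def L2_set_def sum_nonneg matrix_vector_mult_def)
  also have "\<dots> \<le> (\<Sum>i\<in>UNIV. (\<Sum>k\<in>UNIV. (cmod (A $ i $ k))\<^sup>2) * (\<Sum>k\<in>UNIV. (cmod (x $ k))\<^sup>2))"
  proof (intro sum_mono)
    fix i :: 'n
    have "cmod (\<Sum>k\<in>UNIV. A $ i $ k * x $ k) \<le> (\<Sum>k\<in>UNIV. cmod (A $ i $ k) * cmod (x $ k))"
      by (rule order_trans[OF norm_sum]) (simp add: norm_mult)
    then have "(cmod (\<Sum>k\<in>UNIV. A $ i $ k * x $ k))\<^sup>2
        \<le> (\<Sum>k\<in>UNIV. cmod (A $ i $ k) * cmod (x $ k))\<^sup>2"
      by (intro power_mono) auto
    also have "\<dots> \<le> (\<Sum>k\<in>UNIV. (cmod (A $ i $ k))\<^sup>2) * (\<Sum>k\<in>UNIV. (cmod (x $ k))\<^sup>2)"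
      by (rule Cauchy_Schwarz_ineq_sum)
    finally show "(cmod (\<Sum>k\<in>UNIV. A $ i $ k * x $ k))\<^sup>2
        \<le> (\<Sum>k\<in>UNIV. (cmod (A $ i $ k))\<^sup>2) * (\<Sum>k\<in>UNIV. (cmod (x $ k))\<^sup>2)" .
  qed
  also have "\<dots> = (norm A)\<^sup>2 * (norm x)\<^sup>2"
    by (simp add: norm_matrix_sq sum_distrib_right norm_vec_def[of x] L2_set_def sum_nonneg)
  finally show ?thesis
    by (intro power2_le_imp_le[of "norm (A *v x)" "norm A * norm x"])
      (simp_all add: power_mult_distrib)
qed

text \<open>Gram-Schmidt needs complex orthogonality; the real inner product on
  \<open>complex^'n\<close> sees only the real part of this form.\<close>

definition herm_form :: "complex^'n^'n \<Rightarrow> complex^'n \<Rightarrow> complex^'n \<Rightarrow> complex" where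
  "herm_form p w v = (\<Sum>i\<in>UNIV. cnj (w $ i) * (p *v v) $ i)"

lemma Re_herm_form: "Re (herm_form p w v) = w \<bullet> (p *v v)"
  by (simp add: herm_form_def inner_vec_def inner_complex_def)

lemma herm_form_diff: "herm_form p w (v - v') = herm_form p w v - herm_form p w v'"
  by (simp add: herm_form_def matrix_vector_mult_diff_distrib right_diff_distrib sum_subtractf)

lemma herm_form_scale: "herm_form p w (a *s v) = a * herm_form p w v"
  by (simp add: herm_form_def vector_scalar_commute sum_distrib_left mult.left_commute)

lemma herm_form_scale_left: "herm_form p (a *s w) v = cnj a * herm_form p w v"
  by (simp add: herm_form_def sum_distrib_left mult.assoc)

lemma herm_form_sum: "herm_form p w (\<Sum>i\<in>F. f i) = (\<Sum>i\<in>F. herm_form p w (f i))"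
proof (induction F rule: infinite_finite_induct)
  case (insert i F)
  have "herm_form p w (a + b) = herm_form p w a + herm_form p w b" for a b
    by (simp add: herm_form_def matrix_vector_right_distrib distrib_left sum.distrib)
  with insert show ?case by simp
qed (simp_all add: herm_form_def)

lemma herm_form_adjoint: "herm_form p w v = cnj (herm_form (adjoint_matrix p) v w)"
proof -
  have "herm_form p w v = (\<Sum>i\<in>UNIV. \<Sum>j\<in>UNIV. cnj (w $ i) * (p $ i $ j * v $ j))"
    by (simp add: herm_form_def matrix_vector_mult_def sum_distrib_left)
  also have "\<dots> = (\<Sum>j\<in>UNIV. \<Sum>i\<in>UNIV. cnj (w $ i) * (p $ i $ j * v $ j))"
    by (rule sum.swap)
  finally show ?thesis
    by (simp add: herm_form_def matrix_vector_mult_def sum_distrib_left mult_ac)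
qed

lemma inner_matrix_vector_adjoint: "w \<bullet> (A *v v) = (adjoint_matrix A *v w) \<bullet> v"
  using arg_cong[OF herm_form_adjoint[of A w v], of Re]
  by (simp add: Re_herm_form inner_commute)

lemma posdef_matrices_iff:
  "p \<in> posdef_matrices \<longleftrightarrow> adjoint_matrix p = p \<and> (\<forall>v. v \<noteq> 0 \<longrightarrow> v \<bullet> (p *v v) > 0)"
  unfolding posdef_matrices_def Re_herm_form[symmetric] herm_form_def by simp

text \<open>Gram-Schmidt for the form of \<open>p\<close>, applied to the standard basis.\<close>

lemma posdef_orthonormal_family:
  fixes p :: "complex^'n^'n"
  assumes p: "p \<in> posdef_matrices" and "finite F"
  shows "\<exists>x :: 'n \<Rightarrow> complex^'n. (\<forall>i\<in>F. \<forall>j. j \<notin> F \<longrightarrow> x i $ j = 0) \<and>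
    (\<forall>i\<in>F. \<forall>j\<in>F. herm_form p (x i) (x j) = (if i = j then 1 else 0))"
  using assms(2)
proof (induction F rule: finite_induct)
  case (insert k F)
  then obtain x :: "'n \<Rightarrow> complex^'n" where supp: "\<And>i j. i \<in> F \<Longrightarrow> j \<notin> F \<Longrightarrow> x i $ j = 0"
    and orth: "\<And>i j. i \<in> F \<Longrightarrow> j \<in> F \<Longrightarrow> herm_form p (x i) (x j) = (if i = j then 1 else 0)"
    by blast
  have herm: "herm_form p a b = cnj (herm_form p b a)" for a b
    using herm_form_adjoint[of p a b] p by (simp add: posdef_matrices_iff)
  \<comment> \<open>The projections are supported in \<open>F\<close>, which omits \<open>k\<close>;
    so the coordinate of \<open>v\<close> at \<open>k\<close> stays 1 and \<open>v\<close> is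
    nonzero.\<close>
  define v where "v = axis k 1 - (\<Sum>i\<in>F. herm_form p (x i) (axis k 1) *s x i)"
  have v_supp: "v $ j = (if j = k then 1 else 0)" if "j \<notin> F" for j
    using that by (simp add: v_def axis_def supp sum.neutral)
  have v_orth: "herm_form p (x j) v = 0" if "j \<in> F" for j
    using that insert.hyps
    by (simp add: v_def herm_form_diff herm_form_sum herm_form_scale orth if_distrib[of "(*) _"]
        cong: if_cong)
  have "v \<noteq> 0" using v_supp[of k] insert.hyps by auto
  then have pos: "Re (herm_form p v v) > 0"
    using p by (simp add: posdef_matrices_iff Re_herm_form)
  define t where "t = Re (herm_form p v v)"
  \<comment> \<open>The Hermitian symmetry makes this value real, so that division by the real
    number \<open>sqrt t\<close> normalises \<open>v\<close>.\<close>
  have vv: "herm_form p v v = complex_of_real t"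
    using arg_cong[OF herm[of v v], of Im] by (simp add: t_def complex_eq_iff)
  define y where "y = complex_of_real (1 / sqrt t) *s v"
  have yy: "herm_form p y y = 1"
    using pos unfolding y_def herm_form_scale herm_form_scale_left vv complex_cnj_complex_of_real
    by (simp add: t_def[symmetric] of_real_mult[symmetric] del: of_real_mult)
  have xy: "herm_form p (x j) y = 0" "herm_form p y (x j) = 0" if "j \<in> F" for j
    using v_orth[OF that] herm[of v "x j"] by (simp_all add: y_def herm_form_scale herm_form_scale_left)
  have y_supp: "y $ j = 0" if "j \<notin> insert k F" for j
    using v_supp[of j] that by (simp add: y_def)
  show ?case
    by (rule exI[of _ "x(k := y)"]) (use insert.hyps supp orth yy xy y_supp in auto)
qed simp

text \<open>If the columns of \<open>M\<close> are orthonormal for the form of \<open>p\<close>,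
  then \<open>adjoint_matrix M ** p ** M\<close> is the identity. Hence \<open>h = p ** M\<close>
  has inverse \<open>adjoint_matrix M\<close>, and \<open>gram h = p\<close>.\<close>

lemma posdef_eq_gram:
  fixes p :: "complex^'n^'n"
  assumes p: "p \<in> posdef_matrices"
  obtains h k where "h ** k = mat 1" "k ** h = mat 1" "gram h = p"
proof -
  obtain x :: "'n \<Rightarrow> complex^'n"
    where orth: "\<And>i j. herm_form p (x i) (x j) = (if i = j then 1 else 0)"
    using posdef_orthonormal_family[OF p, of UNIV] by auto
  define M :: "complex^'n^'n" where "M = (\<chi> i j. x j $ i)"
  have "(adjoint_matrix M ** (p ** M)) $ i $ j = herm_form p (x i) (x j)" for i j
    by (simp add: herm_form_def M_def matrix_matrix_mult_def matrix_vector_mult_def)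
  then have "adjoint_matrix M ** (p ** M) = mat 1"
    by (simp add: vec_eq_iff orth mat_def)
  then have 1: "p ** M ** adjoint_matrix M = mat 1" "adjoint_matrix M ** (p ** M) = mat 1"
    using matrix_left_right_inverse by blast+
  have pH: "adjoint_matrix p = p" using p by (simp add: posdef_matrices_iff)
  have "gram (p ** M) = (p ** M ** adjoint_matrix M) ** p"
    by (simp add: gram_def adjoint_matrix_mult pH matrix_mul_assoc)
  with 1 show ?thesis using that[of "p ** M" "adjoint_matrix M"] by simp
qed

lemma inner_gram: "w \<bullet> (gram A *v w) = (norm (adjoint_matrix A *v w))\<^sup>2"
  by (simp add: gram_def matrix_vector_mul_assoc[symmetric] inner_matrix_vector_adjoint[of w A]
      power2_norm_eq_inner)

section \<open>Logarithms of quadratic forms as Lipschitz functions\<close>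

text \<open>The infinitesimal form of the Lipschitz bound: divided by
  \<open>w \<bullet> (p *v w)\<close>, the left-hand side is the size of the derivative of the
  logarithm of the form in direction \<open>v\<close>. With \<open>p = gram h\<close> and
  \<open>v\<close> written as \<open>h ** a ** adjoint_matrix h\<close>, it is Cauchy-Schwarz for
  \<open>a\<close>.\<close>

lemma inner_le_tangent_norm:
  fixes p v :: "complex^'n^'n"
  assumes p: "p \<in> posdef_matrices" and v: "adjoint_matrix v = v"
  shows "\<bar>w \<bullet> (v *v w)\<bar> \<le> tangent_norm p v * (w \<bullet> (p *v w))"
proof -
  obtain h k where hk: "h ** k = mat 1" "k ** h = mat 1" and h: "gram h = p"
    using posdef_eq_gram[OF p] .
  \<comment> \<open>Translating \<open>p\<close> to the identity turns the tangent norm into the Frobenius norm.\<close>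
  define a where "a = k ** v ** adjoint_matrix k"
  have hk': "adjoint_matrix k ** adjoint_matrix h = mat 1" "adjoint_matrix h ** adjoint_matrix k = mat 1"
    using hk by (simp_all add: adjoint_matrix_mult[symmetric])
  have "gram h ** (adjoint_matrix k ** k) = h ** (adjoint_matrix h ** adjoint_matrix k) ** k"
    by (simp add: gram_def matrix_mul_assoc)
  then have inv: "matrix_inv p = adjoint_matrix k ** k"
    using matrix_inv_unique[of p "adjoint_matrix k ** k"] by (simp add: h hk hk')
  have a: "adjoint_matrix a = a"
    by (simp add: a_def adjoint_matrix_mult v matrix_mul_assoc)
  have "trace (matrix_inv p ** v ** matrix_inv p ** v)
      = trace (adjoint_matrix k ** (k ** v ** adjoint_matrix k ** k ** v))"
    by (simp add: inv matrix_mul_assoc)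
  also have "\<dots> = trace (gram a)"
    by (subst trace_mul_sym) (simp add: gram_def a, simp add: a_def matrix_mul_assoc)
  finally have tn: "tangent_norm p v = norm a"
    by (simp add: tangent_norm_def norm_sq_eq_trace_gram[symmetric])
  have "h ** a ** adjoint_matrix h = (h ** k) ** v ** (adjoint_matrix k ** adjoint_matrix h)"
    by (simp add: a_def matrix_mul_assoc)
  then have "v = h ** a ** adjoint_matrix h" by (simp add: hk hk')
  then have "w \<bullet> (v *v w) = (adjoint_matrix h *v w) \<bullet> (a *v (adjoint_matrix h *v w))"
    by (simp add: matrix_vector_mul_assoc[symmetric] inner_matrix_vector_adjoint[of w h])
  also have "\<bar>\<dots>\<bar> \<le> norm (adjoint_matrix h *v w) * norm (a *v (adjoint_matrix h *v w))"
    by (rule Cauchy_Schwarz_ineq2)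
  also have "\<dots> \<le> norm (adjoint_matrix h *v w) * (norm a * norm (adjoint_matrix h *v w))"
    by (intro mult_left_mono norm_matrix_vector_mult_le) auto
  finally show ?thesis
    unfolding tn unfolding h[symmetric] inner_gram by (simp add: power2_eq_square mult_ac)
qed

lemma bounded_linear_quadratic_form:
  "bounded_linear (\<lambda>A :: complex^'n^'n. w \<bullet> (A *v w))"
proof
  fix A B :: "complex^'n^'n" and r :: real
  show "w \<bullet> ((A + B) *v w) = w \<bullet> (A *v w) + w \<bullet> (B *v w)"
    by (simp add: matrix_vector_mult_add_rdistrib inner_add_right)
  have "(r *\<^sub>R A) *v w = r *\<^sub>R (A *v w)"
    by (simp add: vec_eq_iff matrix_vector_mult_def scaleR_sum_right)
  then show "w \<bullet> ((r *\<^sub>R A) *v w) = r *\<^sub>R (w \<bullet> (A *v w))"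
    by (simp add: inner_scaleR_right)
  show "\<exists>K. \<forall>A :: complex^'n^'n. norm (w \<bullet> (A *v w)) \<le> norm A * K"
  proof (intro exI allI)
    fix A :: "complex^'n^'n"
    show "norm (w \<bullet> (A *v w)) \<le> norm A * (norm w * norm w)"
      using Cauchy_Schwarz_ineq2[of w "A *v w"]
        mult_left_mono[OF norm_matrix_vector_mult_le[of A w], of "norm w"]
      by (simp add: mult_ac)
  qed
qed

text \<open>Gives continuity of the speed along a \<open>C1\<close> curve, so that the integral in
  \<open>curve_length\<close> is a genuine one and not the default value 0.\<close>

lemma tendsto_tangent_norm:
  fixes p v :: "'a \<Rightarrow> complex^'n^'n"
  assumes p: "(p \<longlongrightarrow> p0) F" and v: "(v \<longlongrightarrow> v0) F" and ev: "\<forall>\<^sub>F x in F. p x \<in> posdef_matrices"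
    and p0: "p0 \<in> posdef_matrices"
  shows "((\<lambda>x. tangent_norm (p x) (v x)) \<longlongrightarrow> tangent_norm p0 v0) F"
proof -
  have inv: "q ** matrix_inv q = mat 1 \<and> matrix_inv q ** q = mat 1"
    if q: "q \<in> posdef_matrices" for q :: "complex^'n^'n"
  proof -
    obtain h k where hk: "h ** k = mat 1" "k ** h = mat 1" and h: "gram h = q"
      using posdef_eq_gram[OF q] .
    have "invertible h" "invertible (adjoint_matrix h)"
      using hk adjoint_matrix_mult[of h k] adjoint_matrix_mult[of k h]
      unfolding invertible_def by (metis adjoint_matrix_one)+
    then have "invertible q" unfolding h[symmetric] gram_def by (rule invertible_mult)
    then show ?thesis unfolding invertible_def matrix_inv_def by (rule someI_ex)
  qed
  have "((\<lambda>x. matrix_inv (p x)) \<longlongrightarrow> matrix_inv p0) F"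
    using inv[OF p0] by (intro tendsto_right_inverse_matrix[OF p eventually_mono[OF ev]]) (simp_all add: inv)
  then show ?thesis
    unfolding tangent_norm_def trace_def
    by (intro tendsto_intros tendsto_vec_nth mat_mult.tendsto v)
qed

text \<open>The functions \<open>p \<mapsto> ln (w\<^sup>* p w)\<close> are 1-Lipschitz, which replaces an explicit formula for the
  Riemannian distance.\<close>

lemma log_form_le_curve_length:
  fixes c :: "real \<Rightarrow> complex^'n^'n"
  assumes c: "c C1_differentiable_on {0..1}" and pos: "c ` {0..1} \<subseteq> posdef_matrices" and w: "w \<noteq> 0"
  shows "\<bar>ln (w \<bullet> (c 1 *v w)) - ln (w \<bullet> (c 0 *v w))\<bar> \<le> curve_length c"
proof -
  obtain D where D: "\<And>t. t \<in> {0..1} \<Longrightarrow> (c has_vector_derivative D t) (at t)"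
    and D_cont: "continuous_on {0..1} D"
    using c unfolding C1_differentiable_on_def by blast
  have p: "c t \<in> posdef_matrices" if "t \<in> {0..1}" for t using pos that by blast
  have D_within: "(c has_vector_derivative D t) (at t within {0..1})" if "t \<in> {0..1}" for t
    using D[OF that] by (rule has_vector_derivative_at_within)
  \<comment> \<open>The curve is known to be Hermitian only on \<open>{0..1}\<close>, so derivatives
    are compared within that interval, where they are unique even at the endpoints.\<close>
  have D_herm: "adjoint_matrix (D t) = D t" if t: "t \<in> {0..1}" for t
  proof -
    have "((\<lambda>t. adjoint_matrix (c t)) has_vector_derivative adjoint_matrix (D t)) (at t within {0..1})"
      by (rule bounded_linear.has_vector_derivative[OF bounded_linear_adjoint_matrix D_within[OF t]])
    then have "(c has_vector_derivative adjoint_matrix (D t)) (at t within {0..1})"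
      by (rule has_vector_derivative_transform[OF t, rotated]) (use p in \<open>auto simp: posdef_matrices_iff\<close>)
    then show ?thesis
      using vector_derivative_unique_within_closed_interval[of 0 1 t c] D_within[OF t] t by auto
  qed
  define f where "f t = ln (w \<bullet> (c t *v w))" for t
  define f' where "f' t = (w \<bullet> (D t *v w)) / (w \<bullet> (c t *v w))" for t
  define g where "g t = tangent_norm (c t) (D t)" for t
  have q_pos: "w \<bullet> (c t *v w) > 0" if "t \<in> {0..1}" for t
    using p[OF that] w by (simp add: posdef_matrices_iff)
  have "(f has_vector_derivative f' t) (at t within {0..1})" if t: "t \<in> {0..1}" for t
  proof -
    have "((\<lambda>t. w \<bullet> (c t *v w)) has_real_derivative w \<bullet> (D t *v w)) (at t within {0..1})"
      unfolding has_real_derivative_iff_has_vector_derivative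
      by (rule bounded_linear.has_vector_derivative[OF bounded_linear_quadratic_form D_within[OF t]])
    then show ?thesis
      unfolding f_def f'_def has_real_derivative_iff_has_vector_derivative[symmetric]
      using q_pos[OF t] by (auto intro!: derivative_eq_intros)
  qed
  then have ftc: "(f' has_integral f 1 - f 0) {0..1}"
    by (intro fundamental_theorem_of_calculus) auto
  have "continuous_on {0..1} c"
    using has_vector_derivative_continuous[OF D_within]
    by (auto simp: continuous_on_eq_continuous_within)
  then have "continuous_on {0..1} g"
    unfolding continuous_on_def g_def
    using D_cont p by (auto simp: continuous_on_def eventually_at_filter intro!: tendsto_tangent_norm)
  then have g_int: "g integrable_on {0..1}" by (rule integrable_continuous_interval)
  have "\<bar>f' t\<bar> \<le> g t" if "t \<in> {0..1}" for t
    using inner_le_tangent_norm[OF p[OF that] D_herm[OF that], of w] q_pos[OF that]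
    by (simp add: f'_def g_def field_simps)
  then have "norm (integral {0..1} f') \<le> integral {0..1} g"
    using ftc g_int by (intro integral_norm_bound_integral) auto
  also have "integral {0..1} g = curve_length c"
    unfolding curve_length_def g_def using vector_derivative_at[OF D] by (intro integral_cong) simp
  finally show ?thesis
    using integral_unique[OF ftc] by (simp add: f_def)
qed

lemma gram_posdef:
  fixes A :: "complex^'n^'n"
  assumes "invertible A"
  shows "gram A \<in> posdef_matrices"
proof -
  obtain B where B: "A ** B = mat 1" using assms by (auto simp: invertible_def)
  have "v \<bullet> (gram A *v v) > 0" if "v \<noteq> 0" for v
  proof -
    have "adjoint_matrix B ** adjoint_matrix A = mat 1"
      using B by (simp add: adjoint_matrix_mult[symmetric])
    then have "adjoint_matrix B *v (adjoint_matrix A *v v) = v"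
      by (simp add: matrix_vector_mul_assoc)
    then have "adjoint_matrix A *v v \<noteq> 0"
      using that by (metis matrix_vector_mult_0_right)
    then show ?thesis by (simp add: inner_gram)
  qed
  then show ?thesis by (simp add: posdef_matrices_iff)
qed

text \<open>By this convexity the straight segment is an admissible curve, so the infimum in
  \<open>sym_dist\<close> is over a nonempty set.\<close>

lemma posdef_segment:
  assumes "p \<in> posdef_matrices" "q \<in> posdef_matrices" "0 \<le> t" "t \<le> 1"
  shows "p + t *\<^sub>R (q - p) \<in> (posdef_matrices :: (complex^'n^'n) set)"
proof -
  have "v \<bullet> ((p + t *\<^sub>R (q - p)) *v v) > 0" if v: "v \<noteq> 0" for v
  proof -
    have pos: "v \<bullet> (p *v v) > 0" "v \<bullet> (q *v v) > 0"
      using assms(1,2) v by (auto simp: posdef_matrices_iff)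
    note lin = bounded_linear.linear[OF bounded_linear_quadratic_form[of v]]
    have "v \<bullet> ((p + t *\<^sub>R (q - p)) *v v)
        = v \<bullet> (p *v v) + t * (v \<bullet> (q *v v) - v \<bullet> (p *v v))"
      by (simp add: linear_add[OF lin] linear_scale[OF lin] linear_diff[OF lin] right_diff_distrib)
    also have "\<dots> = (1 - t) * (v \<bullet> (p *v v)) + t * (v \<bullet> (q *v v))"
      by (simp add: algebra_simps)
    also have "\<dots> > 0"
      using assms(3,4) pos
      by (cases "t = 0") (auto intro!: add_nonneg_pos mult_nonneg_nonneg mult_pos_pos)
    finally show ?thesis .
  qed
  then show ?thesis
    using assms(1,2)
    by (simp add: posdef_matrices_iff adjoint_matrix_add adjoint_matrix_scaleR adjoint_matrix_diff)
qed

lemma log_form_le_sym_dist: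
  fixes A B :: "complex^'n^'n"
  assumes A: "invertible A" and B: "invertible B" and w: "w \<noteq> 0"
  shows "\<bar>ln (w \<bullet> (gram B *v w)) - ln (w \<bullet> (gram A *v w))\<bar>
      \<le> sym_dist (A <#\<^bsub>GL\<^esub> unitary_matrices) (B <#\<^bsub>GL\<^esub> unitary_matrices)"
  unfolding sym_dist_def gram_coset
proof (rule cInf_greatest)
  let ?c = "\<lambda>t. gram A + t *\<^sub>R (gram B - gram A)"
  have "?c C1_differentiable_on {0..1}"
    unfolding C1_differentiable_on_def
    by (intro exI[of _ "\<lambda>_. gram B - gram A"]) (auto intro!: derivative_eq_intros)
  moreover have "?c ` {0..1} \<subseteq> posdef_matrices"
    using posdef_segment[OF gram_posdef[OF A] gram_posdef[OF B]] by auto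
  ultimately have "curve_length ?c \<in> {curve_length c |c. c C1_differentiable_on {0..1} \<and>
      c ` {0..1} \<subseteq> posdef_matrices \<and> c 0 \<in> {gram A} \<and> c 1 \<in> {gram B}}"
    by (intro CollectI exI[of _ ?c]) simp
  then show "{curve_length c |c. c C1_differentiable_on {0..1} \<and>
      c ` {0..1} \<subseteq> posdef_matrices \<and> c 0 \<in> {gram A} \<and> c 1 \<in> {gram B}} \<noteq> {}" by blast
next
  fix l
  assume "l \<in> {curve_length c |c. c C1_differentiable_on {0..1} \<and>
      c ` {0..1} \<subseteq> posdef_matrices \<and> c 0 \<in> {gram A} \<and> c 1 \<in> {gram B}}"
  then show "\<bar>ln (w \<bullet> (gram B *v w)) - ln (w \<bullet> (gram A *v w))\<bar> \<le> l"
    using log_form_le_curve_length[OF _ _ w] by force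
qed

section \<open>From small displacement to small defects\<close>

text \<open>Polarization and the parallelogram law bound the bilinear form by \<open>t\<close> on
  unit vectors. Testing with multiples of basis vectors by 1 and by the imaginary unit bounds the
  real and imaginary parts of each entry, hence its modulus by \<open>2 * t\<close>.\<close>

lemma norm_le_quadratic_form_bound:
  fixes E :: "complex^'n^'n"
  assumes E: "adjoint_matrix E = E" and bd: "\<And>v. \<bar>v \<bullet> (E *v v)\<bar> \<le> t * (norm v)\<^sup>2"
  shows "norm E \<le> 2 * real CARD('n) * t"
proof -
  have polar: "\<bar>v \<bullet> (E *v w)\<bar> \<le> t" if "norm v = 1" "norm w = 1" for v w
  proof -
    have sym: "w \<bullet> (E *v v) = v \<bullet> (E *v w)"
      using inner_matrix_vector_adjoint[of w E v] by (simp add: E inner_commute)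
    have "4 * (v \<bullet> (E *v w)) = (v + w) \<bullet> (E *v (v + w)) - (v - w) \<bullet> (E *v (v - w))"
      by (simp add: matrix_vector_right_distrib matrix_vector_mult_diff_distrib inner_add_left
          inner_add_right inner_diff_left inner_diff_right sym)
    moreover have "t * (norm (v + w))\<^sup>2 + t * (norm (v - w))\<^sup>2 = 4 * t"
      using that by (simp add: power2_norm_eq_inner inner_add_left
          inner_add_right inner_diff_left inner_diff_right inner_commute algebra_simps norm_eq_1)
    ultimately show ?thesis using bd[of "v + w"] bd[of "v - w"] by linarith
  qed
  have entry: "cmod (E $ i $ j) \<le> 2 * t" for i j
  proof -
    have Ej: "(E *v axis j 1) $ i = E $ i $ j"
      by (simp add: matrix_vector_mult_def axis_def if_distrib[of "(*) _"] cong: if_cong)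
    have entry_inner: "axis i c \<bullet> (E *v axis j 1) = c \<bullet> (E $ i $ j)" for c
      by (simp add: inner_axis' Ej)
    have "\<bar>c \<bullet> (E $ i $ j)\<bar> \<le> t" if "norm c = 1" for c
    proof -
      have "norm (axis i c) = 1" "norm (axis j (1::complex)) = 1"
        using that by (simp_all add: norm_eq_sqrt_inner inner_axis_axis)
      then show ?thesis using polar[of "axis i c" "axis j 1"] entry_inner by simp
    qed
    from this[of 1] this[of \<i>] have "\<bar>Re (E $ i $ j)\<bar> \<le> t" "\<bar>Im (E $ i $ j)\<bar> \<le> t"
      by (simp_all add: inner_complex_def)
    then show ?thesis using cmod_le[of "E $ i $ j"] by linarith
  qed
  have t: "t \<ge> 0" using order_trans[OF norm_ge_zero entry] by simp
  have "(norm E)\<^sup>2 \<le> (\<Sum>i\<in>(UNIV::'n set). \<Sum>j\<in>(UNIV::'n set). (2 * t)\<^sup>2)"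
    unfolding norm_matrix_sq by (intro sum_mono power_mono entry norm_ge_zero)
  also have "\<dots> = (2 * real CARD('n) * t)\<^sup>2"
    by (simp add: power2_eq_square)
  finally show ?thesis by (rule power2_le_imp_le) (simp add: t)
qed

text \<open>For \<open>w = adjoint_matrix B *v v\<close>, the forms of \<open>gram A\<close> and
  \<open>gram (T ** A)\<close> at \<open>w\<close> are \<open>(norm v)\<^sup>2\<close> and the form
  of \<open>gram (B ** T ** A)\<close> at \<open>v\<close>. The Lipschitz bound keeps their ratio
  between \<open>exp (- d)\<close> and \<open>exp d\<close>, which controls the quadratic form of
  the defect.\<close>

lemma defect_le_of_sym_dist:
  fixes A B T :: "complex^'n^'n"
  assumes AB: "A ** B = mat 1" "B ** A = mat 1" and T: "invertible T"
    and d: "sym_dist (A <#\<^bsub>GL\<^esub> unitary_matrices) ((T ** A) <#\<^bsub>GL\<^esub> unitary_matrices) \<le> d"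
  shows "norm (gram (B ** T ** A) - mat 1) \<le> 2 * real CARD('n) * (exp d - 1)"
proof (rule norm_le_quadratic_form_bound)
  let ?G = "gram (B ** T ** A)"
  show "adjoint_matrix (?G - mat 1) = ?G - mat 1" by (simp add: adjoint_matrix_diff)
  have A: "invertible A" using AB by (auto simp: invertible_def)
  have TA: "invertible (T ** A)" by (rule invertible_mult[OF T A])
  have "norm v = 0 \<or> \<bar>v \<bullet> (?G *v v) - (norm v)\<^sup>2\<bar> \<le> (exp d - 1) * (norm v)\<^sup>2" for v
  proof (cases "v = 0")
    case False
    define w where "w = adjoint_matrix B *v v"
    have "adjoint_matrix A ** adjoint_matrix B = mat 1"
      using AB by (simp add: adjoint_matrix_mult[symmetric])
    then have Aw: "adjoint_matrix A *v w = v"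
      by (simp add: w_def matrix_vector_mul_assoc)
    then have w: "w \<noteq> 0" using False by auto
    have 1: "w \<bullet> (gram A *v w) = (norm v)\<^sup>2" by (simp add: inner_gram Aw)
    have 2: "w \<bullet> (gram (T ** A) *v w) = v \<bullet> (?G *v v)"
    proof -
      have "adjoint_matrix (T ** A) *v w = adjoint_matrix (B ** T ** A) *v v"
        by (simp add: w_def adjoint_matrix_mult matrix_vector_mul_assoc matrix_mul_assoc)
      then show ?thesis by (simp add: inner_gram)
    qed
    define x y where "x = (norm v)\<^sup>2" and "y = v \<bullet> (?G *v v)"
    have x: "x > 0" using False by (simp add: x_def)
    have y: "y > 0"
      using gram_posdef[OF TA] w by (simp add: posdef_matrices_iff 2[symmetric] y_def)
    have ln: "\<bar>ln y - ln x\<bar> \<le> d"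
      using log_form_le_sym_dist[OF A TA w] d by (simp add: 1 2 x_def y_def)
    have up: "y \<le> exp d * x" and lo: "x \<le> exp d * y"
      using ln x y by (simp_all add: ln_ge_iff[symmetric] ln_mult flip: ln_le_cancel_iff)
    have "d \<ge> 0" using ln by linarith
    \<comment> \<open>The ratio bound gives this with \<open>y\<close> in place of \<open>x\<close>
      on the right, which is stronger when \<open>y \<le> x\<close>; otherwise the left-hand side is
      negative.\<close>
    have "x - y \<le> (exp d - 1) * x"
    proof (cases "y \<le> x")
      case True
      have "x - y \<le> (exp d - 1) * y" using lo by (simp add: algebra_simps)
      also have "\<dots> \<le> (exp d - 1) * x" using True \<open>d \<ge> 0\<close> by (intro mult_left_mono) auto
      finally show ?thesis .
    qed (use \<open>d \<ge> 0\<close> x in \<open>smt (verit) mult_nonneg_nonneg one_le_exp_iff\<close>)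
    with up have "\<bar>y - x\<bar> \<le> (exp d - 1) * x" by (simp add: algebra_simps abs_le_iff)
    then show ?thesis by (simp add: x_def y_def)
  qed simp
  then show "\<bar>v \<bullet> ((?G - mat 1) *v v)\<bar> \<le> (exp d - 1) * (norm v)\<^sup>2" for v
    by (cases "v = 0")
      (force simp: matrix_vector_mult_diff_rdistrib inner_diff_right power2_norm_eq_inner)+
qed

section \<open>Unitarizable representations are bounded\<close>

lemma compact_unitary: "compact (unitary_matrices :: (complex^'n^'n) set)"
proof (rule compact_eq_bounded_closed[THEN iffD2], intro conjI)
  have "norm A \<le> sqrt (real CARD('n) * norm (mat 1 :: complex^'n^'n))"
    if "A \<in> unitary_matrices" for A :: "complex^'n^'n"
    using norm_sq_le_norm_gram[of A] that by (intro real_le_rsqrt) (simp add: unitary_matrices_iff_gram)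
  then show "bounded (unitary_matrices :: (complex^'n^'n) set)" by (auto simp: bounded_iff)
  have eq: "unitary_matrices = (gram :: complex^'n^'n \<Rightarrow> _) -` {mat 1}"
    by (auto simp: unitary_matrices_iff_gram)
  have cont: "continuous_on UNIV (gram :: complex^'n^'n \<Rightarrow> _)"
    by (auto simp: continuous_on_def intro: tendsto_gram tendsto_ident_at)
  show "closed (unitary_matrices :: (complex^'n^'n) set)"
    unfolding eq by (rule closed_vimage[OF closed_singleton cont])
qed

text \<open>The image lies in a conjugate of the unitary group, which is compact and hence closed in
  \<open>GL\<close>, so it contains the closure of the image.\<close>

lemma unitary_conj_not_unbounded:
  fixes \<rho> :: "'g \<Rightarrow> complex^'n^'n" and h h' :: "complex^'n^'n"
  assumes h: "h ** h' = mat 1" "h' ** h = mat 1"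
    and uni: "\<And>g. g \<in> carrier G \<Longrightarrow> h' ** \<rho> g ** h \<in> unitary_matrices"
  shows "\<not> unbounded_rep G \<rho>"
proof -
  define K where "K = (\<lambda>u. h ** u ** h') ` unitary_matrices"
  have "compact K"
    unfolding K_def
    by (intro compact_continuous_image compact_unitary)
      (auto simp: continuous_on_def intro!: mat_mult.tendsto tendsto_const tendsto_ident_at)
  have K_GL: "K \<subseteq> carrier GL"
    using h subgroup.subset[OF subgroup_U]
    unfolding K_def GL_def by (auto simp: invertible_def[of h] invertible_def[of h'] intro!: invertible_mult)
  have "\<rho> ` carrier G \<subseteq> K"
  proof clarify
    fix g assume "g \<in> carrier G"
    have "h ** (h' ** \<rho> g ** h) ** h' = (h ** h') ** \<rho> g ** (h ** h')"
      by (simp add: matrix_mul_assoc)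
    then show "\<rho> g \<in> K"
      unfolding K_def using uni[OF \<open>g \<in> carrier G\<close>] by (intro image_eqI) (simp_all add: h)
  qed
  have cpt: "compactin (top_of_set (carrier GL)) K"
    using \<open>compact K\<close> K_GL by (simp add: compactin_subtopology)
  have "closedin (top_of_set (carrier GL)) K"
    using compact_imp_closed[OF \<open>compact K\<close>] K_GL by (simp add: closed_subset)
  then have "top_of_set (carrier GL) closure_of (\<rho> ` carrier G) \<subseteq> K"
    using \<open>\<rho> ` carrier G \<subseteq> K\<close> by (simp add: closure_of_minimal)
  then have "compactin (top_of_set (carrier GL)) (top_of_set (carrier GL) closure_of (\<rho> ` carrier G))"
    using closed_compactin[OF cpt] by simp
  then show ?thesis by (simp add: unbounded_rep_def)
qed

lemma unitarizableI:
  fixes \<rho> :: "'g \<Rightarrow> complex^'n^'n" and h h' :: "complex^'n^'n"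
  assumes \<rho>: "\<rho> \<in> hom G GL" and h: "h ** h' = mat 1" "h' ** h = mat 1"
    and uni: "\<And>g. g \<in> carrier G \<Longrightarrow> h' ** \<rho> g ** h \<in> unitary_matrices"
  shows "unitarizable G \<rho>"
  unfolding unitarizable_def
proof (rule bexI)
  \<comment> \<open>\<open>unitarizable\<close> puts the inverse on the right, so the witness is
    \<open>h'\<close> and its inverse is \<open>h\<close>.\<close>
  show "h' \<in> carrier GL" using h by (auto simp: GL_def invertible_def)
  have "(\<lambda>g. h' ** \<rho> g ** h) \<in> hom G U"
    using hom_GL_conj[OF \<rho> h] uni by (auto simp: hom_def U_def)
  then show "(\<lambda>g. h' ** \<rho> g ** matrix_inv h') \<in> hom G U"
    by (simp add: matrix_inv_unique[OF h(2)])
qed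

section \<open>The displacement gap and deformations of unitary representations\<close>

context FR_group
begin

text \<open>Evaluation at a generator is continuous for pointwise convergence, and only finitely
  many generators impose a condition.\<close>

lemma openin_small_defect:
  "openin (rep_space G) {\<rho> \<in> topspace (rep_space G). \<forall>s\<in>S. norm (gram (\<rho> s :: complex^'n^'n) - mat 1) < \<eta>}"
proof -
  have "openin (rep_space G) {\<rho> \<in> topspace (rep_space G). norm (gram (\<rho> s :: complex^'n^'n) - mat 1) < \<eta>}"
    if s: "s \<in> S" for s
  proof -
    have "continuous_map (product_topology (\<lambda>_. top_of_set (carrier GL)) (carrier G))
        (top_of_set (carrier GL)) (\<lambda>\<rho>. \<rho> s :: complex^'n^'n)"
      using s S_subset by (intro continuous_map_product_projection) auto
    then have "continuous_map (rep_space G) euclidean (\<lambda>\<rho>. \<rho> s :: complex^'n^'n)"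
      unfolding rep_space_def
      by (intro continuous_map_from_subtopology) (simp add: continuous_map_in_subtopology)
    moreover have "continuous_map euclidean euclidean (\<lambda>A :: complex^'n^'n. norm (gram A - mat 1))"
      by (auto simp: continuous_on_def intro!: tendsto_intros tendsto_gram)
    ultimately have "continuous_map (rep_space G) euclidean
        ((\<lambda>A :: complex^'n^'n. norm (gram A - mat 1)) \<circ> (\<lambda>\<rho>. \<rho> s))"
      by (rule continuous_map_compose)
    from openin_continuous_map_preimage[OF this, of "{..<\<eta>}"] show ?thesis
      by (simp add: o_def)
  qed
  \<comment> \<open>The factor \<open>topspace (rep_space G)\<close> covers the case
    \<open>S = {}\<close>, in which the indexed intersection is \<open>UNIV\<close>.\<close>
  moreover have "{\<rho> \<in> topspace (rep_space G). \<forall>s\<in>S. norm (gram (\<rho> s :: complex^'n^'n) - mat 1) < \<eta>}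
      = topspace (rep_space G) \<inter>
        (\<Inter>s\<in>S. {\<rho> \<in> topspace (rep_space G). norm (gram (\<rho> s :: complex^'n^'n) - mat 1) < \<eta>})"
    by auto
  ultimately show ?thesis
    using finite_S by (cases "S = {}") (auto intro!: openin_Int openin_INT)
qed

theorem displacement_gap:
  "\<exists>\<kappa>>0. \<forall>\<rho> :: 'a \<Rightarrow> complex^'n^'n.
      \<rho> \<in> hom G GL \<and> unbounded_rep G \<rho> \<longrightarrow> displacement S \<rho> \<ge> \<kappa>"
proof -
  obtain \<eta> where \<eta>: "\<eta> > 0" and uni: "\<And>\<rho> :: 'a \<Rightarrow> complex^'n^'n. \<rho> \<in> hom G GL \<Longrightarrow>
      (\<And>s. s \<in> S \<Longrightarrow> norm (gram (\<rho> s) - mat 1) \<le> \<eta>) \<Longrightarrow>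
      \<exists>(h :: complex^'n^'n) h'. h ** h' = mat 1 \<and> h' ** h = mat 1 \<and>
        (\<forall>g\<in>carrier G. h' ** \<rho> g ** h \<in> unitary_matrices)"
    using small_defect_unitarizable[where 'n = 'n] by blast
  \<comment> \<open>Solves \<open>2 * real CARD('n) * (exp \<kappa> - 1) = \<eta>\<close>, so that
    displacement at most \<open>\<kappa>\<close> gives defects at most
    \<open>\<eta>\<close>.\<close>
  define \<kappa> where "\<kappa> = ln (1 + \<eta> / (2 * real CARD('n)))"
  have pos: "\<eta> / (2 * real CARD('n)) > 0" using \<eta> by simp
  have \<kappa>: "\<kappa> > 0" "2 * real CARD('n) * (exp \<kappa> - 1) = \<eta>"
    using pos by (simp_all add: \<kappa>_def)
  show ?thesis
  proof (intro exI[of _ \<kappa>] conjI \<kappa>(1) allI impI, elim conjE, rule ccontr)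
    fix \<rho> :: "'a \<Rightarrow> complex^'n^'n"
    assume \<rho>: "\<rho> \<in> hom G GL" and unb: "unbounded_rep G \<rho>" and "\<not> \<kappa> \<le> displacement S \<rho>"
    have "mat 1 <#\<^bsub>GL\<^esub> unitary_matrices \<in> (sym_space :: (complex^'n^'n) set set)"
      unfolding sym_space_def LCOSETS_def by (auto simp: GL_def invertible_def intro!: exI[of _ "mat 1"])
    then have "sym_space \<noteq> ({} :: (complex^'n^'n) set set)" by blast
    then obtain x where x: "x \<in> sym_space" and lt: "(MAX s\<in>S. sym_dist x (\<rho> s <#\<^bsub>GL\<^esub> x)) < \<kappa>"
      using cInf_lessD[of "(\<lambda>x. MAX s\<in>S. sym_dist x (\<rho> s <#\<^bsub>GL\<^esub> x)) ` sym_space" \<kappa>]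
        \<open>\<not> \<kappa> \<le> displacement S \<rho>\<close> unfolding displacement_def by auto
    have small: "sym_dist x (\<rho> s <#\<^bsub>GL\<^esub> x) \<le> \<kappa>" if "s \<in> S" for s
      by (rule order_trans[OF Max_ge less_imp_le[OF lt]]) (use finite_S that in auto)
    obtain A where A: "A \<in> carrier GL" and xA: "x = A <#\<^bsub>GL\<^esub> unitary_matrices"
      using x unfolding sym_space_def LCOSETS_def by blast
    obtain B where AB: "A ** B = mat 1" "B ** A = mat 1"
      using A by (auto simp: GL_def invertible_def)
    \<comment> \<open>Conjugation by \<open>A\<close> moves the point \<open>x\<close> to the coset
      of the identity, where displacement is measured by the defect.\<close>
    define \<sigma> where "\<sigma> g = B ** \<rho> g ** A" for g
    have \<sigma>: "\<sigma> \<in> hom G GL" unfolding \<sigma>_def by (rule hom_GL_conj[OF \<rho> AB])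
    have "norm (gram (\<sigma> s) - mat 1) \<le> \<eta>" if s: "s \<in> S" for s
    proof -
      have \<rho>s: "\<rho> s \<in> carrier GL" using hom_in_carrier[OF \<rho>] s S_subset by blast
      have "\<rho> s <#\<^bsub>GL\<^esub> x = (\<rho> s ** A) <#\<^bsub>GL\<^esub> unitary_matrices"
        using group.lcos_m_assoc[OF group_GL subgroup.subset[OF subgroup_U] \<rho>s A]
        by (simp add: xA GL_def)
      then show ?thesis
        using defect_le_of_sym_dist[OF AB, of "\<rho> s" \<kappa>] small[OF s] \<rho>s
        unfolding \<kappa>(2) by (simp add: xA \<sigma>_def GL_def)
    qed
    from uni[OF \<sigma> this] obtain h h' :: "complex^'n^'n" where h: "h ** h' = mat 1" "h' ** h = mat 1"
      and hu: "\<And>g. g \<in> carrier G \<Longrightarrow> h' ** \<sigma> g ** h \<in> unitary_matrices" by blast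
    have "A ** h ** (h' ** B) = A ** (h ** h') ** B" "h' ** B ** (A ** h) = h' ** (B ** A) ** h"
      by (simp_all add: matrix_mul_assoc)
    then have "A ** h ** (h' ** B) = mat 1" "h' ** B ** (A ** h) = mat 1"
      by (simp_all add: h AB)
    moreover have "h' ** B ** \<rho> g ** (A ** h) \<in> unitary_matrices" if "g \<in> carrier G" for g
      using hu[OF that] by (simp add: \<sigma>_def matrix_mul_assoc)
    ultimately have "\<not> unbounded_rep G \<rho>" by (rule unitary_conj_not_unbounded)
    with unb show False by blast
  qed
qed

text \<open>One open set works for every \<open>\<rho>\<^sub>0\<close> at once, since unitary
  representations have zero defect at each generator.\<close>

theorem near_unitary_unitarizable:
  fixes \<rho>\<^sub>0 :: "'a \<Rightarrow> complex^'n^'n"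
  assumes \<rho>0: "\<rho>\<^sub>0 \<in> hom G U \<inter> extensional (carrier G)"
  shows "\<exists>N. openin (rep_space G) N \<and> \<rho>\<^sub>0 \<in> N \<and> (\<forall>\<rho>\<in>N. unitarizable G \<rho>)"
proof -
  obtain \<eta> where \<eta>: "\<eta> > 0" and uni: "\<And>\<rho> :: 'a \<Rightarrow> complex^'n^'n. \<rho> \<in> hom G GL \<Longrightarrow>
      (\<And>s. s \<in> S \<Longrightarrow> norm (gram (\<rho> s) - mat 1) \<le> \<eta>) \<Longrightarrow>
      \<exists>(h :: complex^'n^'n) h'. h ** h' = mat 1 \<and> h' ** h = mat 1 \<and>
        (\<forall>g\<in>carrier G. h' ** \<rho> g ** h \<in> unitary_matrices)"
    using small_defect_unitarizable[where 'n = 'n] by blast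
  define N where "N = {\<rho> \<in> topspace (rep_space G). \<forall>s\<in>S. norm (gram (\<rho> s :: complex^'n^'n) - mat 1) < \<eta>}"
  have "openin (rep_space G) N" unfolding N_def by (rule openin_small_defect)
  moreover have "\<rho>\<^sub>0 \<in> N"
  proof -
    have hom0: "\<rho>\<^sub>0 \<in> hom G GL" and u0: "\<And>g. g \<in> carrier G \<Longrightarrow> \<rho>\<^sub>0 g \<in> unitary_matrices"
      using \<rho>0 subgroup.subset[OF subgroup_U] by (auto simp: hom_def U_def)
    then have "\<rho>\<^sub>0 \<in> topspace (rep_space G)"
      using \<rho>0 by (auto simp: rep_space_def PiE_iff hom_def)
    moreover have "gram (\<rho>\<^sub>0 s) = mat 1" if "s \<in> S" for s
      using u0 that S_subset by (auto simp: unitary_matrices_iff_gram)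
    ultimately show ?thesis using \<eta> by (simp add: N_def)
  qed
  moreover have "unitarizable G \<rho>" if "\<rho> \<in> N" for \<rho>
  proof -
    have \<rho>: "\<rho> \<in> hom G GL" using that by (simp add: N_def rep_space_def)
    moreover have "norm (gram (\<rho> s) - mat 1) \<le> \<eta>" if "s \<in> S" for s
      using \<open>\<rho> \<in> N\<close> that by (auto simp: N_def intro: less_imp_le)
    ultimately show ?thesis using uni unitarizableI by blast
  qed
  ultimately show ?thesis by blast
qed

end

text \<open>The dimension is \<open>CARD('n)\<close>, which is at least 1 because types are
  nonempty; \<open>\<kappa>\<close> may depend on it.\<close>

theorem corollary1p5:
  fixes \<Gamma> :: "('g, 'b) monoid_scheme" and S :: "'g set"
  assumes "group \<Gamma>"
    and "finite S" and "S \<subseteq> carrier \<Gamma>" and "generate \<Gamma> S = carrier \<Gamma>"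
    and "property_FR \<Gamma>"
  shows "(\<exists>\<kappa>>0. \<forall>\<rho> :: 'g \<Rightarrow> complex^'n^'n.
            \<rho> \<in> hom \<Gamma> GL \<and> unbounded_rep \<Gamma> \<rho> \<longrightarrow> displacement S \<rho> \<ge> \<kappa>)
       \<and> (\<forall>\<rho>\<^sub>0 :: 'g \<Rightarrow> complex^'n^'n.
            \<rho>\<^sub>0 \<in> hom \<Gamma> U \<inter> extensional (carrier \<Gamma>) \<longrightarrow>
            (\<exists>N. openin (rep_space \<Gamma>) N \<and> \<rho>\<^sub>0 \<in> N \<and> (\<forall>\<rho>\<in>N. unitarizable \<Gamma> \<rho>)))"
proof -
  interpret FR_group \<Gamma> S
    using assms by (simp add: FR_group_def FR_group_axioms_def)
  show ?thesis using displacement_gap near_unitary_unitarizable by blast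
qed

end
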